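(* Let $t\ge 3$ be a prime and $q\ge t+1$. Let $\Sigma$ be a $q$-order canonical subgeometry of $\mathrm{PG}(t-1,q^t)$, $\Gamma$ a $(t-3)$-subspace and $\ell_0$ a line with $\Sigma\cap\Gamma=\emptyset=\ell_0\cap\Gamma$, such that $\mathbb{L}=p_{\Gamma,\ell_0}(\Sigma)$ is a scattered $\mathbb{F}_q$-linear set of pseudoregulus type. Let $\hat\sigma$ be a generator of the subgroup of $\mathrm{P\Gamma L}(t,q^t)$ fixing $\Sigma$ pointwise and $P_\Gamma$ a point such that $\langle P_\Gamma,P_\Gamma^{\hat\sigma},\ldots,P_\Gamma^{\hat\sigma^{t-1}}\rangle=\mathrm{PG}(t-1,q^t)$ and $\Gamma=\langle P_\Gamma,\ldots,P_\Gamma^{\hat\sigma^{t-3}}\rangle$. Then there are precisely $\theta_{t-1}\theta_{t-2}/\theta_1$ $q$-order sublines of $\mathbb{L}$ which are projections under $p_{\Gamma,\ell_0}$ of (the points of $\Sigma$ on) normal rational curves of order $t-1$ containing the points $P_\Gamma^{\hat\sigma^i}$, $i=0,1,\ldots,t-1$.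
   Context: $\theta_s=(q^{s+1}-1)/(q-1)$. A $q$-order canonical subgeometry of $\mathrm{PG}(t-1,q^t)=\mathrm{PG}_{q^t}(V)$ is $\{\langle w\rangle_{q^t}: w\in W\setminus\{0\}\}$ for a $t$-dimensional $\mathbb{F}_q$-subspace $W$ of $V$ whose points span the space; the subgroup of $\mathrm{P\Gamma L}(t,q^t)$ fixing it pointwise is cyclic of order $t$. For a point set $X$ disjoint from $\Gamma$, $p_{\Gamma,\ell_0}(X)=\{\langle\Gamma,P\rangle\cap\ell_0:P\in X\}$. An $\mathbb{F}_q$-linear set of rank $n$ in $\mathrm{PG}(1,q^t)$ is $\{\langle u\rangle_{q^t}:\langle u\rangle_{q^t}\cap U\neq\{0\}\}$ for an $n$-dimensional $\mathbb{F}_q$-subspace $U$ of $\mathbb{F}_{q^t}^2$; scattered means it has $(q^n-1)/(q-1)$ points; pseudoregulus type means projectively equivalent to $\{\langle(\lambda,\lambda^q)\rangle_{q^t}:\lambda\in\mathbb{F}_{q^t}^*\}$. A $q$-order subline of $\ell_0\cong\mathrm{PG}(1,q^t)$ is a set projectively equivalent to $\{\langle(a,b)\rangle: (a,b)\in\mathbb{F}_q^2\setminus\{0\}\}$. A normal rational curve of order $t-1$ in $\mathrm{PG}(t-1,q^t)$ is an image under $\mathrm{PGL}(t,q^t)$ of $\{\langle(1,y,\ldots,y^{t-1})\rangle: y\in\mathbb{F}_{q^t}\}\cup\{\langle(0,\ldots,0,1)\rangle\}$. *)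

theory Defs
  imports
    "HOL-Analysis.Cartesian_Space"
    "HOL-Library.Countable_Set"
    "HOL-Algebra.Bij"
    "HOL-Algebra.Generated_Groups"
    "HOL-Computational_Algebra.Primes"
begin

text \<open>
  The field with \<open>q ^ t\<close> elements is a finite field type \<open>'k\<close>, and
  \<open>PG(t - 1, q ^ t)\<close> is the lattice of subspaces of \<open>'k ^ 'n\<close> with \<open>CARD('n) = t\<close>.
  A projective subspace is represented by its set of vectors; a set of points is
  therefore a set of one-dimensional subspaces.
\<close>

definition theta :: "nat \<Rightarrow> nat \<Rightarrow> real" where
  "theta q s = (real q ^ (s + 1) - 1) / (real q - 1)"

abbreviation pt :: "'k::field ^ 'n \<Rightarrow> ('k ^ 'n) set" where
  "pt v \<equiv> vec.span {v}"

text \<open>The argument \<open>d\<close> is the projective dimension.\<close>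

definition proj_subspace :: "nat \<Rightarrow> ('k::field ^ 'n) set \<Rightarrow> bool" where
  "proj_subspace d S \<longleftrightarrow> vec.subspace S \<and> vec.dim S = d + 1"

definition points_in :: "('k::field ^ 'n) set \<Rightarrow> ('k ^ 'n) set set" where
  "points_in S = {P. proj_subspace 0 P \<and> P \<subseteq> S}"

text \<open>If \<open>CARD('k) = q ^ t\<close> with \<open>t > 0\<close>, then \<open>q\<close> is a power of the characteristic and
  this is the unique subfield with \<open>q\<close> elements.\<close>

definition Fq :: "nat \<Rightarrow> 'k::field set" where
  "Fq q = {x. x ^ q = x}"

text \<open>\<open>W\<close> is an \<open>n\<close>-dimensional vector subspace over the subfield, i.e. the set of
  subfield combinations of \<open>n\<close> vectors that are linearly independent over the subfield.\<close>

definition Fq_subspace :: "nat \<Rightarrow> nat \<Rightarrow> ('k::field ^ 'm) set \<Rightarrow> bool" where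
  "Fq_subspace q n W \<longleftrightarrow> (\<exists>b :: nat \<Rightarrow> 'k ^ 'm.
     (\<forall>c. (\<forall>i<n. c i \<in> Fq q) \<and> (\<Sum>i<n. c i *s b i) = 0 \<longrightarrow> (\<forall>i<n. c i = 0)) \<and>
     W = {\<Sum>i<n. c i *s b i | c. \<forall>i<n. c i \<in> Fq q})"

definition canonical_subgeometry :: "nat \<Rightarrow> ('k::field ^ 'n) set set \<Rightarrow> bool" where
  "canonical_subgeometry q X \<longleftrightarrow> (\<exists>W :: ('k ^ 'n) set.
     Fq_subspace q CARD('n) W \<and> X = {pt w | w. w \<in> W - {0}} \<and> vec.span (\<Union>X) = UNIV)"

text \<open>Collineations are extensional maps on the set of all points, so that they are
  elements of \<^const>\<open>BijGroup\<close> over the point set and semilinear maps that differ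
  by a scalar factor give the same collineation.\<close>

definition field_automorphism :: "('k::field \<Rightarrow> 'k) \<Rightarrow> bool" where
  "field_automorphism \<alpha> \<longleftrightarrow> bij \<alpha> \<and> \<alpha> 1 = 1 \<and>
     (\<forall>x y. \<alpha> (x + y) = \<alpha> x + \<alpha> y) \<and> (\<forall>x y. \<alpha> (x * y) = \<alpha> x * \<alpha> y)"

definition semilinear_bij :: "('k::field ^ 'n \<Rightarrow> 'k ^ 'n) \<Rightarrow> bool" where
  "semilinear_bij f \<longleftrightarrow> bij f \<and> (\<forall>u v. f (u + v) = f u + f v) \<and>
     (\<exists>\<alpha>. field_automorphism \<alpha> \<and> (\<forall>c v. f (c *s v) = \<alpha> c *s f v))"

definition PGammaL :: "(('k::field ^ 'n) set \<Rightarrow> ('k ^ 'n) set) set" where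
  "PGammaL = {restrict ((`) f) (points_in UNIV) | f. semilinear_bij f}"

definition pointwise_stabilizer ::
    "('k::field ^ 'n) set set \<Rightarrow> (('k ^ 'n) set \<Rightarrow> ('k ^ 'n) set) set" where
  "pointwise_stabilizer X = {g \<in> PGammaL. \<forall>P\<in>X. g P = P}"

definition stabilizer_generator ::
    "('k::field ^ 'n) set set \<Rightarrow> (('k ^ 'n) set \<Rightarrow> ('k ^ 'n) set) \<Rightarrow> bool" where
  "stabilizer_generator X \<sigma> \<longleftrightarrow> \<sigma> \<in> pointwise_stabilizer X \<and>
     generate (BijGroup (points_in UNIV)) {\<sigma>} = pointwise_stabilizer X"

definition projection ::
    "('k::field ^ 'n) set \<Rightarrow> ('k ^ 'n) set \<Rightarrow> ('k ^ 'n) set set \<Rightarrow> ('k ^ 'n) set set" where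
  "projection \<Gamma> l X = {vec.span (\<Gamma> \<union> P) \<inter> l | P. P \<in> X}"

text \<open>\<open>Y\<close> is the image of \<open>X\<close> under a projectivity from the space \<open>PG('k ^ 'm)\<close> onto
  the projective subspace \<open>S\<close> of \<open>PG('k ^ 'n)\<close>. For \<open>S = UNIV\<close> this is
  equivalence under the projective general linear group. All reference sets used below
  are invariant under the field automorphisms acting on coordinates, so allowing semilinear
  maps would give the same notions.\<close>

definition projectively_equivalent ::
    "('k::field ^ 'm) set set \<Rightarrow> ('k ^ 'n) set \<Rightarrow> ('k ^ 'n) set set \<Rightarrow> bool" where
  "projectively_equivalent X S Y \<longleftrightarrow> (\<exists>\<phi> :: 'k ^ 'm \<Rightarrow> 'k ^ 'n.
     Vector_Spaces.linear (*s) (*s) \<phi> \<and> inj \<phi> \<and> range \<phi> = S \<and> Y = (`) \<phi> ` X)"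

text \<open>The underlying two-dimensional vector space is the line \<open>l\<close> itself.\<close>

definition linear_set ::
    "nat \<Rightarrow> nat \<Rightarrow> ('k::field ^ 'n) set \<Rightarrow> ('k ^ 'n) set set \<Rightarrow> bool" where
  "linear_set q n l L \<longleftrightarrow>
     (\<exists>U \<subseteq> l. Fq_subspace q n U \<and> L = {P \<in> points_in l. P \<inter> U \<noteq> {0}})"

definition scattered_linear_set ::
    "nat \<Rightarrow> ('k::field ^ 'n) set \<Rightarrow> ('k ^ 'n) set set \<Rightarrow> bool" where
  "scattered_linear_set q l L \<longleftrightarrow>
     (\<exists>n. linear_set q n l L \<and> real (card L) = (real q ^ n - 1) / (real q - 1))"

definition pseudoregulus_type ::
    "nat \<Rightarrow> ('k::field ^ 'n) set \<Rightarrow> ('k ^ 'n) set set \<Rightarrow> bool" where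
  "pseudoregulus_type q l L \<longleftrightarrow>
     projectively_equivalent {pt (vector [x, x ^ q] :: 'k ^ 2) | x. x \<noteq> 0} l L"

definition subline ::
    "nat \<Rightarrow> ('k::field ^ 'n) set \<Rightarrow> ('k ^ 'n) set set \<Rightarrow> bool" where
  "subline q l S \<longleftrightarrow>
     projectively_equivalent
       {pt (vector [a, b] :: 'k ^ 2) | a b. a \<in> Fq q \<and> b \<in> Fq q \<and> (a, b) \<noteq> (0, 0)} l S"

text \<open>Here \<open>to_nat_on UNIV\<close> numbers the coordinates by \<open>0, ..., CARD('n) - 1\<close>. Another
  numbering would give an image of the curve under a permutation of coordinates, hence the
  same class of normal rational curves.\<close>

definition standard_nrc :: "('k::field ^ 'n) set set" where
  "standard_nrc =
     {pt (\<chi> i. y ^ to_nat_on (UNIV :: 'n set) i) | y. True} \<union>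
     {pt (\<chi> i. if to_nat_on (UNIV :: 'n set) i = CARD('n) - 1 then 1 else 0)}"

definition normal_rational_curve :: "('k::field ^ 'n) set set \<Rightarrow> bool" where
  "normal_rational_curve C \<longleftrightarrow>
     projectively_equivalent (standard_nrc :: ('k ^ 'n) set set) UNIV C"

end

theory Submission
  imports Defs "HOL-Algebra.Sylow" "HOL-Algebra.Multiplicative_Group"
    "HOL-Computational_Algebra.Polynomial"
begin

text \<open>
  Let \<open>\<alpha>\<close> be the field automorphism belonging to \<open>\<sigma>\<close>. In the frame \<open>P, \<sigma> P, \<dots>\<close> of \<open>t\<close> points, the
  subgeometry consists of the points with coordinates \<open>(a, \<alpha> a, \<alpha>\<^sup>2 a, \<dots>)\<close>, and projecting from
  \<open>\<Gamma>\<close> keeps the last two coordinates; since \<open>\<alpha>\<close> has fixed field \<open>Fq q\<close>, this is injective on the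
  subgeometry. The quadratic transformation inverting all coordinates maps the subgeometry to
  itself and interchanges the normal rational curves through the frame points with lines. So a
  curve meeting the subgeometry in at least two points meets it in \<open>{1 / c | c \<in> M - {0}}\<close> for a
  two-dimensional \<open>Fq q\<close>-subspace \<open>M\<close> of the field. Conversely every such \<open>M\<close> arises, because \<open>t\<close>
  is prime and hence the \<open>t\<close> conjugates of the ratio of two basis elements of \<open>M\<close> are distinct; its
  image is a subline because \<open>(1 / \<alpha>\<^sup>t\<^sup>-\<^sup>2 c, 1 / \<alpha>\<^sup>t\<^sup>-\<^sup>1 c)\<close> is proportional to
  \<open>(\<alpha>\<^sup>t\<^sup>-\<^sup>1 c, \<alpha>\<^sup>t\<^sup>-\<^sup>2 c)\<close>. The sublines are thus counted by the lines of \<open>PG(t - 1, q)\<close>.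
\<close>

section \<open>Finite fields\<close>

text \<open>Sylow's theorem for the additive group gives a subgroup of order \<open>r\<close>. A
  nonzero \<open>x\<close> in it satisfies \<open>of_nat r * x = 0\<close>, so \<open>r\<close>
  vanishes in the field.\<close>

lemma CHAR_unique_prime_dvd_card:
  assumes "prime r" "r dvd CARD('k::{field,finite})"
  shows "r = CHAR('k)"
proof -
  define G where "G = \<lparr>carrier = (UNIV :: 'k set), monoid.mult = (+), one = (0 :: 'k)\<rparr>"
  interpret group G
  proof (rule groupI)
    fix x assume "x \<in> carrier G"
    show "\<exists>y\<in>carrier G. y \<otimes>\<^bsub>G\<^esub> x = \<one>\<^bsub>G\<^esub>"
      by (intro bexI[of _ "-x"]) (auto simp: G_def)
  qed (auto simp: G_def add_ac)
  obtain m where "CARD('k) = r ^ 1 * m" using assms(2) by (auto elim: dvdE)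
  then obtain H where H: "subgroup H G" "card H = r ^ 1"
    using sylow_thm[of r G 1 m] assms(1) is_group by (auto simp: Coset.order_def G_def)
  have "card H > 1" using H(2) assms(1) prime_gt_1_nat by auto
  hence "\<not> H \<subseteq> {0}" using card_mono[of "{0 :: 'k}" H] by auto
  then obtain x where x: "x \<in> H" "x \<noteq> 0" by auto
  interpret H: group "G\<lparr>carrier := H\<rparr>"
    using H(1) subgroup.subgroup_is_group is_group by blast
  have pow: "x [^]\<^bsub>G\<^esub> n = of_nat n * x" for n :: nat
    by (induction n) (auto simp: G_def nat_pow_def algebra_simps)
  have "x [^]\<^bsub>G\<lparr>carrier := H\<rparr>\<^esub> card H = \<one>\<^bsub>G\<^esub>"
    using H.pow_order_eq_1[of x] x(1) by (simp add: Coset.order_def)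
  hence "x [^]\<^bsub>G\<^esub> card H = 0" by (simp add: nat_pow_def G_def)
  hence "of_nat r = (0 :: 'k)" using pow x H(2) by simp
  hence "CHAR('k) dvd r" by (simp add: of_nat_eq_0_iff_char_dvd)
  moreover have "CHAR('k) \<noteq> 1" by simp
  ultimately show ?thesis using assms(1) by (auto simp: prime_nat_iff)
qed

lemma prime_CHAR_finite: "prime CHAR('k::{field,finite})"
  using prime_CHAR_semidom[where 'a='k] finite_imp_CHAR_pos[where 'a='k] by simp

lemma nat_prime_power_if_unique_prime_dvd:
  fixes n p :: nat
  assumes "n > 0" "prime p" "\<And>r. prime r \<Longrightarrow> r dvd n \<Longrightarrow> r = p"
  shows "\<exists>k. n = p ^ k"
proof -
  obtain m where m: "n = p ^ multiplicity p n * m" "\<not> p dvd m"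
    using multiplicity_decompose'[of n p] assms by (auto simp: prime_nat_iff)
  have "m = 1"
  proof (rule ccontr)
    assume "m \<noteq> 1"
    then obtain r where "prime r" "r dvd m" using prime_factor_nat by blast
    with assms(3) m show False by (metis dvd_mult)
  qed
  with m show ?thesis by auto
qed

text \<open>Every prime divisor of \<open>q\<close> divides the order of the field and so is the
  characteristic. Hence \<open>q\<close> is a power of the characteristic and the freshman's dream
  applies.\<close>

lemma frobenius_add:
  fixes x y :: "'k::{field,finite}"
  assumes "CARD('k) = q ^ t" "t > 0"
  shows "(x + y) ^ q = x ^ q + y ^ q"
proof -
  have "q > 0" using assms finite_UNIV_card_ge_0[where 'a='k] by (cases "q = 0") (auto simp: power_0_left)
  moreover have "r = CHAR('k)" if "prime r" "r dvd q" for r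
    using CHAR_unique_prime_dvd_card[where 'k='k] that assms
    by (auto intro: dvd_trans[OF _ dvd_power])
  ultimately obtain k where "q = CHAR('k) ^ k"
    using nat_prime_power_if_unique_prime_dvd prime_CHAR_finite by blast
  thus ?thesis using freshmans_dream' prime_CHAR_finite by metis
qed

text \<open>Multiplication by a nonzero \<open>x\<close> permutes the nonzero elements, so their
  product is unchanged although each factor acquires an \<open>x\<close>.\<close>

lemma power_CARD: "(x :: 'k::{field,finite}) ^ CARD('k) = x"
proof (cases "x = 0")
  case False
  obtain n where n: "CARD('k) = Suc n"
    using finite_UNIV_card_ge_0[where 'a='k] by (metis finite gr0_conv_Suc)
  have "x * (\<Prod>y\<in>UNIV-{0}. x * y) = x ^ CARD('k) * \<Prod>(UNIV-{0})"
    by (simp add: prod.distrib mult_ac n)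
  also have "(\<Prod>y\<in>UNIV-{0}. x * y) = (\<Prod>y\<in>UNIV-{0}. y)"
    by (rule prod.reindex_bij_witness[of _ "\<lambda>y. y / x" "\<lambda>y. x * y"]) (use False in auto)
  finally show ?thesis by simp
qed (use finite_UNIV_card_ge_0[where 'a='k] in auto)

text \<open>The polynomial X^(q^t) - X vanishes everywhere and factors as \<open>f * g\<close> with
  \<open>f\<close> equal to X^q - X and \<open>g\<close> of degree at most q^t - q. So
  \<open>f\<close> has at least \<open>q\<close> roots, and by its degree at most
  \<open>q\<close>.\<close>

lemma card_Fq:
  assumes "CARD('k::{field,finite}) = q ^ t" "t > 0"
  shows "card (Fq q :: 'k set) = q"
proof -
  have q1: "q > 1"
  proof (rule ccontr)
    assume "\<not> q > 1"
    hence "q = 0 \<or> q = 1" by auto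
    hence "CARD('k) \<le> 1" using assms by (auto simp: power_0_left)
    moreover have "card {0, 1::'k} \<le> CARD('k)" by (rule card_mono) auto
    ultimately show False by simp
  qed
  define a b where "a = q - 1" and "b = (\<Sum>i<t. q ^ i)"
  have ab: "Suc (a * b) = q ^ t"
  proof -
    have "Suc (a * (\<Sum>i<n. Suc a ^ i)) = Suc a ^ n" for n
      by (induction n) (auto simp: algebra_simps)
    moreover have "q = Suc a" using q1 by (simp add: a_def)
    ultimately show ?thesis by (simp add: b_def)
  qed
  have a0: "a > 0" using q1 by (simp add: a_def)
  have b0: "b > 0" using ab q1 one_less_power[OF q1 assms(2)] by (cases "b = 0") auto
  \<comment> \<open>Since \<open>a * b\<close> is q^t - 1, this is the geometric series for (X^(q^t
    - 1) - 1) / (X^(q - 1) - 1).\<close>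
  define g :: "'k poly" where "g = (\<Sum>i<b. monom 1 (a * i))"
  define f :: "'k poly" where "f = monom 1 q - monom 1 1"
  have fg: "x ^ (q ^ t) - x = poly f x * poly g x" for x
  proof -
    have "x ^ (a * b) - 1 = (x ^ a - 1) * (\<Sum>i<b. (x ^ a) ^ i)"
      by (simp only: power_mult power_diff_1_eq)
    moreover have "poly f x = x * (x ^ a - 1)"
      using q1 power_eq_if[of x q] by (simp add: f_def poly_monom a_def right_diff_distrib)
    moreover have "poly g x = (\<Sum>i<b. (x ^ a) ^ i)"
      by (simp add: g_def poly_sum poly_monom power_mult)
    moreover have "x ^ (q ^ t) = x * x ^ (a * b)"
      unfolding ab[symmetric] by simp
    moreover have "x * x ^ (a * b) - x = x * (x ^ (a * b) - 1)" by (simp add: right_diff_distrib)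
    ultimately show ?thesis by (simp only: mult.assoc)
  qed
  have g0: "coeff g 0 = 1"
    using a0 b0 by (auto simp: g_def coeff_sum sum.remove[of _ "0::nat"])
  have gnz: "g \<noteq> 0" using g0 by auto
  have "degree g \<le> a * (b - 1)"
    unfolding g_def by (rule degree_sum_le) (auto simp: degree_monom_eq)
  hence "card {x. poly g x = 0} \<le> a * (b - 1)" using card_poly_roots_bound[OF gnz] by linarith
  moreover have "UNIV \<subseteq> Fq q \<union> {x. poly g x = 0}"
  proof
    fix x :: 'k
    have "poly f x * poly g x = 0" using fg[of x] power_CARD[of x] assms by simp
    thus "x \<in> Fq q \<union> {x. poly g x = 0}" by (auto simp: f_def poly_monom Fq_def)
  qed
  hence "q ^ t \<le> card (Fq q :: 'k set) + card {x. poly g x = 0}"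
    using assms(1) by (metis card_Un_le card_mono finite order_trans)
  moreover have "q ^ t = a * (b - 1) + q"
  proof -
    have "q = Suc a" using q1 by (simp add: a_def)
    moreover have "a * b = a * (b - 1) + a" using b0 by (cases b) auto
    ultimately show ?thesis using ab by linarith
  qed
  ultimately have "q \<le> card (Fq q :: 'k set)" by linarith
  moreover have "f \<noteq> 0" using q1 by (auto simp: f_def poly_eq_iff coeff_monom intro!: exI[of _ q])
  hence "card (Fq q :: 'k set) \<le> degree f"
    using card_poly_roots_bound[of f] by (simp add: f_def poly_monom Fq_def)
  moreover have "degree f \<le> q" unfolding f_def using q1 by (intro degree_diff_le) (auto simp: degree_monom_eq)
  ultimately show ?thesis by simp
qed

text \<open>The polynomial \<open>\<Prod>i<t. X - x ^ (q ^ i)\<close> has coefficients in \<open>Fq q\<close>, so \<open>\<alpha> x\<close> is one of its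
  roots \<open>x ^ (q ^ i)\<close>; the exponent \<open>i\<close> may depend on \<open>x\<close>.\<close>

lemma automorphism_funpow_id:
  fixes \<alpha> :: "'k::{field,finite} \<Rightarrow> 'k"
  assumes card: "CARD('k) = q ^ t" "t > 0"
    and \<alpha>: "field_automorphism \<alpha>" and fixes_Fq: "\<And>x. x \<in> Fq q \<Longrightarrow> \<alpha> x = x"
  shows "(\<alpha> ^^ t) x = x"
proof -
  have q1: "q > 1"
    using card_Fq[OF card] card_mono[of "Fq q" "{0, 1::'k}"] card
    by (cases "q = 0") (auto simp: Fq_def)
  have add: "\<alpha> (x + y) = \<alpha> x + \<alpha> y" and mult: "\<alpha> (x * y) = \<alpha> x * \<alpha> y" and one: "\<alpha> 1 = 1" for x y
    using \<alpha> by (auto simp: field_automorphism_def)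
  have zero: "\<alpha> 0 = 0" using add[of 0 0] by (metis add_cancel_left_right)
  have sum: "\<alpha> (sum h A) = (\<Sum>i\<in>A. \<alpha> (h i))" for h and A :: "nat set"
    by (induction A rule: infinite_finite_induct) (auto simp: add zero)
  have power: "\<alpha> (x ^ n) = \<alpha> x ^ n" for x n by (induction n) (auto simp: one mult)
  have fsum: "(sum h A) ^ q = (\<Sum>i\<in>A. h i ^ q)" for h :: "nat \<Rightarrow> 'k" and A
    using q1 by (induction A rule: infinite_finite_induct) (auto simp: frobenius_add[OF card])
  define f where "f = (\<Prod>i<t. [:- (x ^ (q ^ i)), 1:])"
  have pf: "poly f y = (\<Prod>i<t. y - x ^ (q ^ i))" for y by (simp add: f_def poly_prod)
  have deg: "degree f = t" by (simp add: f_def degree_prod_sum_eq)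
  have fneg: "(y - z) ^ q = y ^ q - z ^ q" for y z :: 'k
    using frobenius_add[OF card, of "y - z" z] by (simp add: algebra_simps)
  \<comment> \<open>Taking \<open>q\<close>-th powers shifts the roots \<open>x ^ (q ^ i)\<close>
    cyclically because \<open>x ^ (q ^ t)\<close> is \<open>x\<close>. The two products are compared
    after multiplication by \<open>y ^ q - x\<close>, so the case where this factor vanishes is
    separate.\<close>
  have frob: "poly f y ^ q = poly f (y ^ q)" for y
  proof -
    have "poly f y ^ q = (\<Prod>i<t. y ^ q - x ^ (q ^ Suc i))"
      by (simp add: pf prod_power_distrib fneg power_mult[symmetric] mult.commute)
    also have "\<dots> * (y ^ q - x ^ (q ^ 0)) = (\<Prod>i<t. y ^ q - x ^ (q ^ i)) * (y ^ q - x ^ (q ^ t))"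
      using prod.lessThan_Suc_shift[of "\<lambda>i. y ^ q - x ^ (q ^ i)" t]
      by (simp add: mult.commute)
    finally have *: "poly f y ^ q * (y ^ q - x) = poly f (y ^ q) * (y ^ q - x)"
      using power_CARD[of x] card(1) by (simp add: pf)
    show ?thesis
    proof (cases "y ^ q = x")
      case True
      hence "poly f (y ^ q) = 0" using card(2) by (auto simp: pf intro!: bexI[of _ 0])
      moreover have "y - x ^ (q ^ (t - 1)) = 0"
      proof -
        have "x ^ (q ^ (t - 1)) = y ^ (q ^ t)"
          using True card(2) by (metis Suc_diff_1 power_Suc power_mult)
        thus ?thesis using power_CARD[of y] card(1) by simp
      qed
      hence "poly f y = 0" using card(2) by (auto simp: pf intro!: bexI[of _ "t - 1"])
      ultimately show ?thesis using q1 by simp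
    qed (use * in simp)
  qed
  \<comment> \<open>The coefficients measure how far those of \<open>f\<close> are from
    \<open>Fq q\<close>. This polynomial vanishes at all \<open>q ^ t\<close> elements and has
    degree at most \<open>t\<close>, hence is zero.\<close>
  define g where "g = (\<Sum>k\<le>t. monom (coeff f k ^ q - coeff f k) k)"
  have "poly g z = 0" for z
  proof -
    define y where "y = z ^ (q ^ (t - 1))"
    have yz: "y ^ q = z"
      using power_CARD[of z] card by (simp add: y_def power_mult[symmetric] mult.commute flip: power_Suc)
    have "poly g z = (\<Sum>k\<le>t. coeff f k ^ q * z ^ k) - (\<Sum>k\<le>t. coeff f k * z ^ k)"
      by (simp add: g_def poly_sum poly_monom algebra_simps sum_subtractf)
    also have "(\<Sum>k\<le>t. coeff f k ^ q * z ^ k) = (\<Sum>k\<le>t. (coeff f k * y ^ k) ^ q)"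
      by (rule sum.cong) (auto simp: power_mult_distrib yz[symmetric] power_mult[symmetric] mult.commute)
    also have "\<dots> = (\<Sum>k\<le>t. coeff f k * y ^ k) ^ q" by (rule fsum[symmetric])
    also have "\<dots> = poly f y ^ q" by (simp add: poly_altdef deg)
    also have "\<dots> = poly f z" by (simp add: frob yz)
    also have "\<dots> = (\<Sum>k\<le>t. coeff f k * z ^ k)" by (simp add: poly_altdef deg)
    finally show ?thesis by simp
  qed
  moreover have "degree g \<le> t" unfolding g_def
    by (intro degree_sum_le) (auto intro: order_trans[OF degree_monom_le])
  moreover have "t < q ^ t" using q1 by (intro power_gt_expt) auto
  ultimately have "g = 0"
    using card_poly_roots_bound[of g] card(1) by force
  have coef: "coeff f k \<in> Fq q" if "k \<le> t" for k
  proof -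
    have "coeff g k = coeff f k ^ q - coeff f k"
      using that by (simp add: g_def coeff_sum)
    thus ?thesis using \<open>g = 0\<close> by (simp add: Fq_def)
  qed
  have "poly f x = 0" using card(2) by (auto simp: pf intro!: bexI[of _ 0])
  hence "0 = \<alpha> (\<Sum>k\<le>t. coeff f k * x ^ k)" by (simp add: poly_altdef deg zero)
  also have "\<dots> = poly f (\<alpha> x)" by (simp add: poly_altdef deg sum mult power fixes_Fq coef)
  finally obtain i where i: "\<alpha> x = x ^ (q ^ i)" by (auto simp: pf)
  \<comment> \<open>\<open>\<alpha>\<close> commutes with powers, so on the powers of this fixed
    \<open>x\<close> it acts as raising to the power \<open>q ^ i\<close>.\<close>
  have "(\<alpha> ^^ n) x = x ^ ((q ^ i) ^ n)" for n
    by (induction n) (auto simp: power i power_mult[symmetric] mult.commute)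
  hence "(\<alpha> ^^ t) x = x ^ ((q ^ t) ^ i)" by (simp add: power_mult[symmetric] mult.commute)
  also have "\<dots> = x"
    using power_CARD[where 'k='k] card(1) by (induction i) (auto simp: power_mult)
  finally show ?thesis .
qed

section \<open>Normal rational curves through the base points\<close>

abbreviation idx :: "'n::finite \<Rightarrow> nat" where
  "idx \<equiv> to_nat_on UNIV"

abbreviation moment :: "'k::field \<Rightarrow> 'k ^ 'n" where
  "moment y \<equiv> \<chi> i. y ^ idx i"

abbreviation moment_inf :: "'k::field ^ 'n" where
  "moment_inf \<equiv> \<chi> i. if idx i = CARD('n) - 1 then 1 else 0"

lemma bij_idx: "bij_betw (idx :: 'n::finite \<Rightarrow> nat) UNIV {..<CARD('n)}"
  using to_nat_on_finite[of "UNIV :: 'n set"] by simp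

lemma idx_less: "idx (i :: 'n::finite) < CARD('n)"
  using bij_betwE[OF bij_idx[where ?'n = 'n]] by auto

lemma idx_le: "idx (i :: 'n::finite) \<le> CARD('n) - Suc 0"
  using idx_less[of i] by linarith

lemma idx_eq_iff: "idx (i :: 'n::finite) = idx j \<longleftrightarrow> i = j"
  using bij_idx[where ?'n = 'n] by (auto simp: bij_betw_def inj_def)

lemma ex_other_index:
  assumes "CARD('n::finite) \<ge> 2"
  shows "\<exists>j :: 'n. j \<noteq> i"
proof (rule ccontr)
  assume "\<nexists>j. j \<noteq> i"
  hence "(UNIV :: 'n set) = {i}" by auto
  hence "CARD('n) = card {i}" by simp
  with assms show False by simp
qed

lemma ex_idx:
  assumes "j < CARD('n::finite)"
  shows "\<exists>i :: 'n. idx i = j"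
  using bij_betw_imp_surj_on[OF bij_idx[where ?'n = 'n]] assms by (metis imageE lessThan_iff)

lemma sum_idx: "(\<Sum>i\<in>UNIV. g (idx (i :: 'n::finite))) = (\<Sum>j<CARD('n). g j)"
  by (rule sum.reindex_bij_betw[OF bij_idx])

lemma pt_eqD:
  assumes "pt u = pt v"
  shows "\<exists>c. u = c *s v"
proof -
  have "u \<in> pt v" using assms vec.span_base[of u "{u}"] by auto
  thus ?thesis by (auto simp: vec.span_singleton)
qed

lemma pt_scale: "c \<noteq> 0 \<Longrightarrow> pt (c *s v) = pt v"
  by (simp add: vec.span_singleton set_eq_iff image_iff)
     (metis (no_types, opaque_lifting) nonzero_eq_divide_eq vector_smult_assoc)

lemma linear_image_pt:
  "Vector_Spaces.linear (*s) (*s) f \<Longrightarrow> f ` pt v = pt (f v)"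
  using vec.linear_span_image[of f "{v}"] by simp

text \<open>With \<open>coeff_eq_sum_idx\<close> this lets a matrix row be read as a polynomial:
  pairing with \<open>moment y\<close> evaluates it, pairing with \<open>moment_inf\<close> extracts
  the top coefficient.\<close>

lemma poly_eq_sum_idx:
  assumes "degree (p :: 'k::field poly) < CARD('n::finite)"
  shows "(\<Sum>i\<in>UNIV. coeff p (idx (i :: 'n)) * y ^ idx i) = poly p y"
proof -
  have "(\<Sum>i\<in>UNIV. coeff p (idx (i :: 'n)) * y ^ idx i) = (\<Sum>j<CARD('n). coeff p j * y ^ j)"
    by (rule sum_idx)
  also have "\<dots> = (\<Sum>j\<le>degree p. coeff p j * y ^ j)"
    using assms by (intro sum.mono_neutral_right) (auto simp: coeff_eq_0)
  finally show ?thesis by (simp add: poly_altdef)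
qed

lemma coeff_eq_sum_idx:
  "(\<Sum>i\<in>UNIV. coeff (p :: 'k::field poly) (idx (i :: 'n::finite)) *
      (if idx i = CARD('n) - 1 then 1 else 0)) = coeff p (CARD('n) - 1)"
proof -
  have "(\<Sum>i\<in>UNIV. coeff p (idx (i :: 'n)) * (if idx i = CARD('n) - 1 then 1 else 0)) =
        (\<Sum>j<CARD('n). coeff p j * (if j = CARD('n) - 1 then 1 else 0))"
    by (rule sum_idx)
  also have "\<dots> = coeff p (CARD('n) - 1)"
    by (subst sum.remove[of _ "CARD('n) - 1"]) (auto intro!: sum.neutral)
  finally show ?thesis .
qed

text \<open>Multiplying coordinate \<open>i\<close> by its missing factor gives the full product. So
  up to a common scalar the coordinates are the inverses of \<open>A i * y + B i\<close>: the curve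
  is the inverse of the line spanned by \<open>A\<close> and \<open>B\<close>. By \<open>AB\<close>
  the linear factors have distinct roots, and these parameters give the unit points.\<close>

lemma nrc_of_pencil:
  fixes A B :: "'n::finite \<Rightarrow> 'k::field"
  assumes A: "\<And>i. A i \<noteq> 0" and AB: "\<And>i j. i \<noteq> j \<Longrightarrow> A i * B j \<noteq> A j * B i"
  obtains \<phi> :: "'k ^ 'n \<Rightarrow> 'k ^ 'n" where
    "Vector_Spaces.linear (*s) (*s) \<phi>" "bij \<phi>"
    "\<And>y i. \<phi> (moment y) $ i = (\<Prod>j\<in>UNIV-{i}. A j * y + B j)"
    "\<And>i. \<phi> moment_inf $ i = (\<Prod>j\<in>UNIV-{i}. A j)"
    "\<And>i. pt (axis i 1) \<in> (`) \<phi> ` standard_nrc"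
proof -
  define p where "p i = (\<Prod>j\<in>UNIV-{i}. [:B j, A j:])" for i
  have deg: "degree (p i) = CARD('n) - 1" for i
    using A by (simp add: p_def degree_prod_sum_eq card_Diff_singleton)
  have dlt: "degree (p i) < CARD('n)" for i by (simp add: deg)
  define R :: "'k ^ 'n ^ 'n" where "R = (\<chi> i k. coeff (p i) (idx k))"
  define \<phi> where "\<phi> = (*v) R"
  have lin: "Vector_Spaces.linear (*s) (*s) \<phi>" by (simp add: \<phi>_def)
  have mom: "\<phi> (moment y) $ i = (\<Prod>j\<in>UNIV-{i}. A j * y + B j)" for y i
  proof -
    have "\<phi> (moment y) $ i = poly (p i) y"
      by (simp add: \<phi>_def R_def matrix_vector_mult_def poly_eq_sum_idx[OF dlt])
    thus ?thesis by (simp add: p_def poly_prod algebra_simps)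
  qed
  have inf: "\<phi> moment_inf $ i = (\<Prod>j\<in>UNIV-{i}. A j)" for i
  proof -
    have "\<phi> moment_inf $ i = lead_coeff (p i)"
      by (simp only: \<phi>_def R_def matrix_vector_mult_def vec_lambda_beta coeff_eq_sum_idx deg)
    thus ?thesis using A by (simp add: p_def lead_coeff_prod)
  qed
  have "\<exists>y d. d \<noteq> 0 \<and> \<phi> (moment y) = d *s axis i 1" for i
  proof -
    \<comment> \<open>At the root of the \<open>i\<close>-th factor, which occurs in every
      coordinate except the \<open>i\<close>-th, only coordinate \<open>i\<close> survives.\<close>
    define y where "y = - B i / A i"
    define d where "d = (\<Prod>j\<in>UNIV-{i}. A j * y + B j)"
    have "A j * y + B j \<noteq> 0" if "j \<noteq> i" for j
      using A[of i] AB[OF that] by (simp add: y_def field_simps)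
    hence d: "d \<noteq> 0" by (simp add: d_def)
    have "\<phi> (moment y) $ j = 0" if "j \<noteq> i" for j
      using A[of i] that by (auto simp: mom y_def intro!: bexI[of _ i])
    hence "\<phi> (moment y) = d *s axis i 1"
      by (auto simp: vec_eq_iff axis_def mom d_def)
    with d show ?thesis by blast
  qed
  then obtain y d where yd: "\<And>i. d i \<noteq> 0" "\<And>i. \<phi> (moment (y i)) = d i *s axis i 1"
    by metis
  have base: "pt (axis i 1) \<in> (`) \<phi> ` standard_nrc" for i
  proof -
    have "pt (axis i 1) = pt (\<phi> (moment (y i)))" by (simp only: yd pt_scale not_False_eq_True)
    also have "\<dots> = \<phi> ` pt (moment (y i))" by (rule linear_image_pt[OF lin, symmetric])
    finally show ?thesis unfolding standard_nrc_def by blast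
  qed
  have "axis i 1 \<in> range \<phi>" for i
  proof -
    have "\<phi> (inverse (d i) *s moment (y i)) = axis i 1"
      using yd[of i] by (simp add: vec.linear_scale[OF lin])
    thus ?thesis by (metis rangeI)
  qed
  hence "cart_basis \<subseteq> range \<phi>" by (auto simp: cart_basis_def)
  moreover have "vec.subspace (range \<phi>)"
    using vec.linear_subspace_image[OF lin vec.subspace_UNIV] .
  ultimately have "surj \<phi>"
    using vec.span_minimal span_cart_basis by blast
  hence "bij \<phi>" using vec.linear_surj_imp_inj[OF lin] by (simp add: bij_def)
  with lin mom inf base show ?thesis using that by blast
qed

lemma prod_linear_factors_dvd:
  fixes p :: "'k::field poly"
  assumes "finite A" "inj_on y A" "\<And>a. a \<in> A \<Longrightarrow> poly p (y a) = 0"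
  shows "(\<Prod>a\<in>A. [:- y a, 1:]) dvd p"
  using assms
proof (induction A arbitrary: p)
  case (insert a A)
  obtain r where r: "p = [:- y a, 1:] * r"
    using insert.prems(2)[of a] by (auto simp: poly_eq_0_iff_dvd elim: dvdE)
  have "poly r (y b) = 0" if "b \<in> A" for b
    using insert.prems(2)[of b] insert.prems(1) insert.hyps that
    by (auto simp: r inj_on_def)
  hence "(\<Prod>a\<in>A. [:- y a, 1:]) dvd r" using insert.prems(1) by (intro insert.IH) auto
  thus ?case using insert.hyps by (simp add: r mult_dvd_mono del: mult_pCons_left)
qed simp

text \<open>The standard quadratic transformation \<open>z\<^sub>i \<mapsto> 1 / z\<^sub>i\<close> maps a normal rational curve through the
  base points into a line, spanned by \<open>g\<close> and \<open>h\<close>.\<close>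

lemma inverse_nrc_in_pencil:
  fixes \<phi> :: "'k::field ^ 'n \<Rightarrow> 'k ^ 'n"
  assumes n2: "CARD('n) \<ge> 2"
    and lin: "Vector_Spaces.linear (*s) (*s) \<phi>" and "inj \<phi>"
    and base: "\<And>i. pt (axis i 1) \<in> (`) \<phi> ` standard_nrc"
  shows "\<exists>g h :: 'n \<Rightarrow> 'k. \<forall>z. pt z \<in> (`) \<phi> ` standard_nrc \<longrightarrow> (\<forall>i. z $ i \<noteq> 0) \<longrightarrow>
    (\<exists>r s. \<forall>i. inverse (z $ i) = r * g i + s * h i)"
proof -
  let ?N = "CARD('n)"
  have surj: "surj \<phi>" using vec.linear_inj_imp_surj[OF lin \<open>inj \<phi>\<close>] .
  \<comment> \<open>Row \<open>i\<close> of the matrix as a polynomial: it parametrizes coordinate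
    \<open>i\<close> of the curve.\<close>
  define P where "P i = (\<Sum>k\<in>UNIV. monom (matrix \<phi> $ i $ k) (idx (k :: 'n)))" for i
  have degP: "degree (P i) \<le> ?N - 1" for i
    unfolding P_def
    by (intro degree_sum_le) (auto intro!: order_trans[OF degree_monom_le] idx_le)
  have coeffP: "coeff (P i) (idx k) = matrix \<phi> $ i $ k" for i and k :: 'n
  proof -
    have "coeff (P i) (idx k) = (\<Sum>l\<in>UNIV. if l = k then matrix \<phi> $ i $ l else 0)"
      unfolding P_def coeff_sum by (rule sum.cong) (auto simp: idx_eq_iff)
    thus ?thesis by simp
  qed
  have \<phi>: "\<phi> x $ i = (\<Sum>k\<in>UNIV. coeff (P i) (idx k) * x $ k)" for x i
    using matrix_works[OF lin, of x]
    by (simp add: coeffP matrix_vector_mult_def vec_eq_iff)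
  have dlt: "degree (P i) < ?N" for i using degP[of i] n2 by linarith
  have mom: "\<phi> (moment y) $ i = poly (P i) y" for y i
    by (simp add: \<phi> poly_eq_sum_idx[OF dlt])
  have inf: "\<phi> moment_inf $ i = coeff (P i) (?N - 1)" for i
    by (simp only: \<phi> vec_lambda_beta coeff_eq_sum_idx)
  have Pnz: "P i \<noteq> 0" for i
  proof
    assume "P i = 0"
    hence "\<phi> x $ i = 0" for x by (simp add: \<phi>)
    thus False using surj by (metis axis_nth surjD zero_neq_one)
  qed
  have scale: "\<exists>d. d \<noteq> 0 \<and> z = d *s \<phi> x" if "pt z = \<phi> ` pt x" "z \<noteq> 0" for z x
    using that pt_eqD[of z "\<phi> x"] by (auto simp: linear_image_pt[OF lin])
  \<comment> \<open>\<open>only_nz y i\<close> says that the parameter \<open>y\<close> gives the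
    \<open>i\<close>-th base point, so \<open>J\<close> collects the base points with a finite
    parameter. At most one is missing from it, the one at infinity.\<close>
  define only_nz where "only_nz y i \<longleftrightarrow> (\<forall>j. poly (P j) y = 0 \<longleftrightarrow> j \<noteq> i)" for y i
  define J where "J = {i. \<exists>y. only_nz y i}"
  have cases: "i \<in> J \<or> (\<forall>j. coeff (P j) (?N - 1) = 0 \<longleftrightarrow> j \<noteq> i)" for i
  proof -
    have nz: "axis i (1 :: 'k) \<noteq> 0" by (metis axis_nth zero_index zero_neq_one)
    from base[of i] consider y where "pt (axis i 1) = \<phi> ` pt (moment y)"
      | "pt (axis i 1) = \<phi> ` pt moment_inf"
      unfolding standard_nrc_def by auto
    thus ?thesis
    proof cases
      case (1 y)
      obtain d where "d \<noteq> 0" "axis i 1 = d *s \<phi> (moment y)" using scale[OF 1 nz] by auto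
      hence eq: "d * poly (P j) y = axis i 1 $ j" for j by (simp add: mom)
      have "poly (P j) y = (if j = i then inverse d else 0)" for j
        using \<open>d \<noteq> 0\<close> eq[of j] by (auto simp: axis_def field_simps split: if_splits)
      hence "only_nz y i" using \<open>d \<noteq> 0\<close> by (simp add: only_nz_def)
      thus ?thesis by (auto simp: J_def)
    next
      case 2
      obtain d where "d \<noteq> 0" "axis i 1 = d *s \<phi> moment_inf" using scale[OF 2 nz] by auto
      hence eq: "d * coeff (P j) (?N - 1) = axis i 1 $ j" for j by (simp add: inf del: One_nat_def)
      have "coeff (P j) (?N - 1) = (if j = i then inverse d else 0)" for j
        using \<open>d \<noteq> 0\<close> eq[of j] by (auto simp: axis_def field_simps split: if_splits)
      thus ?thesis using \<open>d \<noteq> 0\<close> by simp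
    qed
  qed
  define y where "y i = (SOME y. only_nz y i)" for i
  have yJ: "only_nz (y i) i" if "i \<in> J" for i
    using that someI_ex[of "\<lambda>y. only_nz y i"] by (simp add: J_def y_def)
  have inj: "inj_on y J"
  proof (rule inj_onI)
    fix i j assume "i \<in> J" "j \<in> J" "y i = y j"
    thus "i = j" using yJ[of i] yJ[of j] by (auto simp: only_nz_def)
  qed
  \<comment> \<open>If the base point \<open>i0\<close> lies at infinity, then \<open>P i\<close>
    for any other \<open>i\<close> lacks its coefficient of degree \<open>?N - 1\<close>, which
    compensates for the root missing from \<open>J - {i}\<close>.\<close>
  have card_J: "?N - 1 \<le> card (J - {i}) \<or> (coeff (P i) (?N - 1) = 0 \<and> ?N - 2 \<le> card (J - {i}))" for i
  proof (cases "J = UNIV")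
    case True thus ?thesis by (simp add: card_Diff_singleton)
  next
    case False
    then obtain i0 where i0: "i0 \<notin> J" by auto
    have "j \<in> J" if "j \<noteq> i0" for j using cases[of j] cases[of i0] i0 that by auto
    hence J: "J = UNIV - {i0}" using i0 by auto
    show ?thesis
    proof (cases "i = i0")
      case True
      hence "J - {i} = UNIV - {i0}" using J by auto
      thus ?thesis by (simp add: card_Diff_singleton)
    next
      case False
      hence "card (J - {i}) = ?N - 1 - 1" by (simp add: J card_Diff_singleton)
      moreover have "coeff (P i) (?N - 1) = 0" using cases[of i0] i0 False by blast
      ultimately show ?thesis by (simp only: diff_diff_left one_add_one order_refl simp_thms)
    qed
  qed
  \<comment> \<open>The known roots exhaust the degree of \<open>P i\<close>, so the cofactor is
    constant.\<close>
  have "\<exists>c. c \<noteq> 0 \<and> P i = smult c (\<Prod>j\<in>J-{i}. [:- y j, 1:])" for i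
  proof -
    let ?F = "\<Prod>j\<in>J-{i}. [:- y j, 1:]"
    have "?F dvd P i"
      by (rule prod_linear_factors_dvd) (use inj yJ in \<open>auto simp: only_nz_def inj_on_def\<close>)
    then obtain r where r: "P i = ?F * r" by (elim dvdE)
    have dF: "degree ?F = card (J - {i})" by (simp add: degree_prod_sum_eq)
    have "r \<noteq> 0" "?F \<noteq> 0" using Pnz[of i] r by auto
    hence dP: "degree (P i) = card (J - {i}) + degree r" by (simp add: r degree_mult_eq dF)
    have "degree (P i) \<le> card (J - {i})"
    proof (cases "?N - 1 \<le> card (J - {i})")
      case False
      hence "coeff (P i) (?N - 1) = 0" "?N - 2 \<le> card (J - {i})" using card_J[of i] by auto
      moreover have "degree (P i) \<noteq> ?N - 1" using calculation(1) Pnz[of i] by (metis leading_coeff_0_iff)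
      ultimately show ?thesis using degP[of i] by linarith
    qed (use degP[of i] in linarith)
    with dP have "degree r = 0" by simp
    then obtain c where "r = [:c:]" by (rule degree_eq_zeroE)
    with r \<open>r \<noteq> 0\<close> show ?thesis by (intro exI[of _ c]) (auto simp: mult.commute)
  qed
  then obtain c where c: "\<And>i. c i \<noteq> 0" "\<And>i. P i = smult (c i) (\<Prod>j\<in>J-{i}. [:- y j, 1:])"
    by metis
  \<comment> \<open>With \<open>G\<close> the product of \<open>x - y j\<close> over
    \<open>J\<close>, the inverse of \<open>poly (P i) x\<close> is
    \<open>(x - y i) / (c i * G)\<close> for \<open>i\<close> in \<open>J\<close> and
    \<open>1 / (c i * G)\<close> otherwise. The numerators are linear in \<open>x\<close>;
    \<open>g\<close> holds the coefficient of \<open>x\<close> and \<open>h\<close> the constant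
    term, both divided by \<open>c i\<close>.\<close>
  define g where "g i = (if i \<in> J then 1 / c i else 0)" for i
  define h where "h i = (if i \<in> J then - y i / c i else 1 / c i)" for i
  have other: "\<exists>j. j \<noteq> i" for i :: 'n using ex_other_index[OF n2] .
  show ?thesis
  proof (rule exI[of _ g], rule exI[of _ h], intro allI impI)
    fix z :: "'k ^ 'n"
    assume z: "pt z \<in> (`) \<phi> ` standard_nrc" and nz': "\<forall>i. z $ i \<noteq> 0"
    have nz: "z $ i \<noteq> 0" for i using nz' by blast
    have z0: "z \<noteq> 0" using nz by (metis zero_index)
    from z consider x where "pt z = \<phi> ` pt (moment x)" | "pt z = \<phi> ` pt moment_inf"
      unfolding standard_nrc_def by auto
    thus "\<exists>r s. \<forall>i. inverse (z $ i) = r * g i + s * h i"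
    proof cases
      case (1 x)
      obtain d where d: "d \<noteq> 0" "z = d *s \<phi> (moment x)" using scale[OF 1 z0] by auto
      have Px: "poly (P i) x \<noteq> 0" for i using nz[of i] d by (auto simp: mom)
      have xy: "x \<noteq> y j" if "j \<in> J" for j
        using other[of j] Px yJ[OF that] by (auto simp: only_nz_def)
      define G where "G = (\<Prod>j\<in>J. x - y j)"
      have G: "G \<noteq> 0" using xy by (simp add: G_def)
      have "inverse (z $ i) = (x / (d * G)) * g i + (1 / (d * G)) * h i" for i
      proof (cases "i \<in> J")
        case True
        define E where "E = (\<Prod>j\<in>J-{i}. x - y j)"
        have "G = (x - y i) * E" using True by (simp add: G_def E_def prod.remove[of J i])
        moreover have "z $ i = d * (c i * E)" using d by (simp add: mom c(2) poly_prod E_def)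
        ultimately show ?thesis
          using d G c(1)[of i] True by (simp add: g_def h_def divide_simps)
      next
        case False
        hence "z $ i = d * (c i * G)" using d by (simp add: mom c(2) poly_prod G_def)
        thus ?thesis using False by (simp add: g_def h_def divide_simps)
      qed
      thus ?thesis by blast
    next
      case 2
      obtain d where d: "d \<noteq> 0" "z = d *s \<phi> moment_inf" using scale[OF 2 z0] by auto
      have Pn: "coeff (P i) (?N - 1) \<noteq> 0" for i using nz[of i] d by (auto simp: inf simp del: One_nat_def)
      \<comment> \<open>An index outside \<open>J\<close> would be the base point at infinity, where
        all other coordinates vanish, against \<open>Pn\<close>.\<close>
      hence JU: "J = UNIV" using cases other by blast
      have "coeff (P i) (?N - 1) = c i" for i
      proof -
        have "degree (\<Prod>j\<in>UNIV-{i}. [:- y j, 1:]) = ?N - 1"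
          by (simp add: degree_prod_sum_eq card_Diff_singleton)
        moreover have "lead_coeff (\<Prod>j\<in>UNIV-{i}. [:- y j, 1:]) = 1" by (simp add: lead_coeff_prod)
        ultimately show ?thesis by (simp add: c(2) JU del: One_nat_def)
      qed
      hence "inverse (z $ i) = (1 / d) * g i + 0 * h i" for i
        using d c(1)[of i] by (simp add: inf g_def JU field_simps del: One_nat_def)
      thus ?thesis by blast
    qed
  qed
qed

section \<open>Field automorphisms of prime order\<close>

lemma det2_nz_imp_zero:
  fixes u v a b c d :: "'a::field"
  assumes "u * a + v * b = 0" "u * c + v * d = 0" "a * d \<noteq> b * c"
  shows "u = 0 \<and> v = 0"
proof -
  have "u * (a * d - b * c) = d * (u * a + v * b) - b * (u * c + v * d)"
    and "v * (a * d - b * c) = a * (u * c + v * d) - c * (u * a + v * b)"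
    by (simp_all add: algebra_simps)
  hence "u * (a * d - b * c) = 0" "v * (a * d - b * c) = 0" by (simp_all only: assms(1,2)) simp_all
  thus ?thesis using assms(3) by simp
qed

text \<open>Isolates what the count uses of the collineation: the fixed field of its automorphism
  and the period \<open>t\<close>.\<close>

locale field_aut =
  fixes \<alpha> :: "'k::{field,finite} \<Rightarrow> 'k" and q t :: nat
  assumes aut: "field_automorphism \<alpha>"
    and fixed_iff: "\<alpha> x = x \<longleftrightarrow> x \<in> Fq q"
    and period: "(\<alpha> ^^ t) x = x"
    and card_k: "CARD('k) = q ^ t"
    and prime_t: "prime t"
    and t_ge: "t \<ge> 3"
begin

lemma \<alpha>_add [simp]: "\<alpha> (x + y) = \<alpha> x + \<alpha> y"
  and \<alpha>_mult [simp]: "\<alpha> (x * y) = \<alpha> x * \<alpha> y"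
  and \<alpha>_1 [simp]: "\<alpha> 1 = 1"
  using aut by (auto simp: field_automorphism_def)

lemma \<alpha>_eq_iff [simp]: "\<alpha> x = \<alpha> y \<longleftrightarrow> x = y"
  using aut by (auto simp: field_automorphism_def bij_def inj_def)

lemma \<alpha>_0 [simp]: "\<alpha> 0 = 0"
  using \<alpha>_add[of 0 0] by (metis add_cancel_left_right)

lemma \<alpha>_diff [simp]: "\<alpha> (x - y) = \<alpha> x - \<alpha> y"
  using \<alpha>_add[of "x - y" y] by (simp add: algebra_simps)

lemma \<alpha>_divide [simp]: "\<alpha> (x / y) = \<alpha> x / \<alpha> y"
proof (cases "y = 0")
  case False
  moreover have "\<alpha> (x / y) * \<alpha> y = \<alpha> x" using False by (simp flip: \<alpha>_mult)
  moreover have "\<alpha> y \<noteq> 0" using False \<alpha>_eq_iff[of y 0] by simp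
  ultimately show ?thesis by (simp add: field_simps)
qed simp

lemma funpow_hom:
  "(\<alpha> ^^ n) (x + y) = (\<alpha> ^^ n) x + (\<alpha> ^^ n) y"
  "(\<alpha> ^^ n) (x * y) = (\<alpha> ^^ n) x * (\<alpha> ^^ n) y"
  "(\<alpha> ^^ n) (x / y) = (\<alpha> ^^ n) x / (\<alpha> ^^ n) y"
  "(\<alpha> ^^ n) 1 = 1"
  by (induction n) auto

lemma funpow_eq_iff: "(\<alpha> ^^ n) x = (\<alpha> ^^ n) y \<longleftrightarrow> x = y"
  by (induction n) auto

lemma funpow_eq_0_iff [simp]: "(\<alpha> ^^ n) x = 0 \<longleftrightarrow> x = 0"
proof -
  have "(\<alpha> ^^ n) 0 = 0" by (induction n) auto
  thus ?thesis using funpow_eq_iff[of n x 0] by simp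
qed

lemma funpow_Fq: "x \<in> Fq q \<Longrightarrow> (\<alpha> ^^ n) x = x"
  by (induction n) (auto simp: fixed_iff)

lemma Fq_closed:
  fixes x y :: 'k
  shows "x \<in> Fq q \<Longrightarrow> y \<in> Fq q \<Longrightarrow> x + y \<in> Fq q"
  "x \<in> Fq q \<Longrightarrow> y \<in> Fq q \<Longrightarrow> x * y \<in> Fq q"
  "0 \<in> (Fq q :: 'k set)" "1 \<in> (Fq q :: 'k set)"
  by (simp_all flip: fixed_iff)

lemma card_Fq': "card (Fq q :: 'k set) = q"
  using card_Fq[OF card_k] t_ge by simp

text \<open>The exponents whose iterates fix \<open>x\<close> include multiples of \<open>i\<close>
  and of \<open>t\<close>. These are coprime since \<open>t\<close> is prime, so by Bezout two such
  multiples differ by 1.\<close>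

lemma funpow_fixed:
  assumes "0 < i" "i < t" "(\<alpha> ^^ i) x = x"
  shows "\<alpha> x = x"
proof -
  have it: "(\<alpha> ^^ (i * m)) x = x" "(\<alpha> ^^ (t * m)) x = x" for m
    by (induction m) (auto simp: funpow_add assms(3) period)
  have "coprime i t"
    using assms prime_t by (metis coprime_commute nat_dvd_not_less prime_imp_coprime)
  then obtain a b where "i * a = t * b + 1"
    using bezout_nat[of i t] assms by (auto simp: coprime_iff_gcd_eq_1)
  hence "(\<alpha> ^^ Suc (t * b)) x = x" using it(1)[of a] by simp
  thus ?thesis using it(2)[of b] by simp
qed

text \<open>A Moore determinant with \<open>\<alpha>\<close> in place of Frobenius: it is nonzero
  exactly when \<open>a\<close> and \<open>b\<close> are linearly independent over the fixed field,
  zero arguments included.\<close>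

definition indep :: "'k \<Rightarrow> 'k \<Rightarrow> bool" where
  "indep a b \<longleftrightarrow> a * \<alpha> b \<noteq> b * \<alpha> a"

definition span2 :: "'k \<Rightarrow> 'k \<Rightarrow> 'k set" where
  "span2 a b = {x * a + y * b | x y. x \<in> Fq q \<and> y \<in> Fq q}"

lemma indep_nz: "indep a b \<Longrightarrow> a \<noteq> 0" "indep a b \<Longrightarrow> b \<noteq> 0"
  by (auto simp: indep_def)

lemma not_indep_iff: "a \<noteq> 0 \<Longrightarrow> \<not> indep a b \<longleftrightarrow> b / a \<in> Fq q"
  using \<alpha>_eq_iff[of a 0] by (simp add: indep_def field_simps flip: fixed_iff del: \<alpha>_eq_iff)

text \<open>Equality would make two conjugates of \<open>b / a\<close> coincide; then a proper
  iterate of \<open>\<alpha>\<close> fixes \<open>b / a\<close>, which by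
  \<open>funpow_fixed\<close> lies in \<open>Fq q\<close>.\<close>

lemma indep_funpow:
  assumes "indep a b" "i \<noteq> j" "i < t" "j < t"
  shows "(\<alpha> ^^ i) a * (\<alpha> ^^ j) b \<noteq> (\<alpha> ^^ j) a * (\<alpha> ^^ i) b"
proof
  assume eq: "(\<alpha> ^^ i) a * (\<alpha> ^^ j) b = (\<alpha> ^^ j) a * (\<alpha> ^^ i) b"
  have a: "a \<noteq> 0" using assms(1) by (rule indep_nz)
  have u: "(\<alpha> ^^ i) (b / a) = (\<alpha> ^^ j) (b / a)"
    using eq a by (simp add: funpow_hom field_simps)
  have *: False if "i < j" "j < t" "(\<alpha> ^^ i) (b / a) = (\<alpha> ^^ j) (b / a)" for i j
  proof -
    have "(\<alpha> ^^ i) (b / a) = (\<alpha> ^^ i) ((\<alpha> ^^ (j - i)) (b / a))"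
      using that by (metis add_diff_inverse_nat comp_apply funpow_add less_imp_not_less)
    hence "\<alpha> (b / a) = b / a"
      using that by (intro funpow_fixed[of "j - i"]) (auto simp: funpow_eq_iff)
    with assms(1) a show False using not_indep_iff fixed_iff by blast
  qed
  show False using *[of i j] *[of j i] u assms by (cases "i < j") auto
qed

text \<open>Applying \<open>\<alpha>\<close> to the equations for i = 0, 1 and comparing with those
  for i = 1, 2 gives a homogeneous system for \<open>x - \<alpha> x\<close> and
  \<open>y - \<alpha> y\<close>. Its determinant is the image under \<open>\<alpha>\<close> of the
  one in \<open>indep\<close>, so \<open>x\<close> and \<open>y\<close> are fixed.\<close>

lemma combination_in_span2:
  assumes ind: "indep a b"
    and c: "\<And>i. i < t \<Longrightarrow> (\<alpha> ^^ i) c = x * (\<alpha> ^^ i) a + y * (\<alpha> ^^ i) b"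
  shows "c \<in> span2 a b"
proof -
  have 0: "c = x * a + y * b" using c[of 0] t_ge by simp
  have 1: "\<alpha> c = x * \<alpha> a + y * \<alpha> b" using c[of 1] t_ge by simp
  have 2: "\<alpha> (\<alpha> c) = x * \<alpha> (\<alpha> a) + y * \<alpha> (\<alpha> b)" using c[of 2] t_ge by (simp add: eval_nat_numeral)
  define u v where "u = x - \<alpha> x" and "v = y - \<alpha> y"
  have "u * \<alpha> a + v * \<alpha> b = 0" using arg_cong[OF 0, of \<alpha>] 1 by (simp add: u_def v_def algebra_simps)
  moreover have "u * \<alpha> (\<alpha> a) + v * \<alpha> (\<alpha> b) = 0"
    using arg_cong[OF 1, of \<alpha>] 2 by (simp add: u_def v_def algebra_simps)
  moreover have "\<alpha> a * \<alpha> (\<alpha> b) \<noteq> \<alpha> b * \<alpha> (\<alpha> a)"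
    using ind \<alpha>_eq_iff[of "a * \<alpha> b" "b * \<alpha> a"] by (simp add: indep_def del: \<alpha>_eq_iff)
  ultimately have "u = 0 \<and> v = 0" by (rule det2_nz_imp_zero)
  hence "x \<in> Fq q" "y \<in> Fq q" by (simp_all add: u_def v_def flip: fixed_iff)
  with 0 show ?thesis by (auto simp: span2_def)
qed

lemma span2_funpow:
  assumes "x \<in> Fq q" "y \<in> Fq q"
  shows "(\<alpha> ^^ i) (x * a + y * b) = x * (\<alpha> ^^ i) a + y * (\<alpha> ^^ i) b"
  using assms by (simp add: funpow_hom funpow_Fq)

section \<open>Counting bases of two-dimensional subspaces over the fixed field\<close>

lemma card_span2:
  assumes "indep a b"
  shows "card (span2 a b) = q\<^sup>2"
proof -
  have "inj_on (\<lambda>(x, y). x * a + y * b) (Fq q \<times> Fq q)"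
  proof (clarsimp simp: inj_on_def)
    fix x y x' y' assume F: "x \<in> Fq q" "y \<in> Fq q" "x' \<in> Fq q" "y' \<in> Fq q"
      and eq: "x * a + y * b = x' * a + y' * b"
    have "x * \<alpha> a + y * \<alpha> b = x' * \<alpha> a + y' * \<alpha> b"
      using arg_cong[OF eq, of \<alpha>] F by (simp flip: fixed_iff)
    with eq assms have "x - x' = 0 \<and> y - y' = 0"
      by (intro det2_nz_imp_zero[of _ a _ b "\<alpha> a" "\<alpha> b"]) (auto simp: indep_def algebra_simps)
    thus "x = x' \<and> y = y'" by simp
  qed
  moreover have "span2 a b = (\<lambda>(x, y). x * a + y * b) ` (Fq q \<times> Fq q)"
    by (auto simp: span2_def)
  ultimately show ?thesis
    by (simp add: card_image card_cartesian_product card_Fq' power2_eq_square)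
qed

lemma span2_base: "a \<in> span2 a b" "b \<in> span2 a b"
  using Fq_closed(3,4) by (force simp: span2_def)+

lemma span2_closed:
  assumes "c \<in> span2 a b" "d \<in> span2 a b" "x \<in> Fq q" "y \<in> Fq q"
  shows "x * c + y * d \<in> span2 a b"
proof -
  obtain c1 c2 d1 d2 where F: "c1 \<in> Fq q" "c2 \<in> Fq q" "d1 \<in> Fq q" "d2 \<in> Fq q"
    and cd: "c = c1 * a + c2 * b" "d = d1 * a + d2 * b"
    using assms(1,2) unfolding span2_def by blast
  have "x * c + y * d = (x * c1 + y * d1) * a + (x * c2 + y * d2) * b"
    by (simp add: cd algebra_simps)
  thus ?thesis unfolding span2_def using F assms(3,4) Fq_closed(1,2) by blast
qed

lemma span2_eq:
  assumes "indep a b" "indep c d" "c \<in> span2 a b" "d \<in> span2 a b"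
  shows "span2 c d = span2 a b"
proof (rule card_subset_eq)
  show "span2 c d \<subseteq> span2 a b" using span2_closed[OF assms(3,4)] by (auto simp: span2_def[of c d])
qed (auto simp: card_span2 assms)

text \<open>For nonzero \<open>a\<close> exactly the \<open>q\<close> multiples of \<open>a\<close>
  by \<open>Fq q\<close> fail to be independent of it, and they all lie in \<open>M\<close>.\<close>

lemma card_indep_pairs:
  assumes "0 \<in> M" and cl: "\<And>x c. x \<in> Fq q \<Longrightarrow> c \<in> M \<Longrightarrow> x * c \<in> M"
  shows "card {(a, b). a \<in> M \<and> b \<in> M \<and> indep a b} = (card M - 1) * (card M - q)"
proof -
  have "card {b \<in> M. indep a b} = card M - q" if "a \<in> M - {0}" for a
  proof -
    have "{b \<in> M. indep a b} = M - (\<lambda>x. x * a) ` Fq q"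
    proof -
      have "indep a b \<longleftrightarrow> b \<notin> (\<lambda>x. x * a) ` Fq q" for b
        using not_indep_iff[of a b] that by (force simp: image_iff field_simps)
      thus ?thesis by auto
    qed
    moreover have "card ((\<lambda>x. x * a) ` (Fq q :: 'k set)) = q"
      using that by (subst card_image) (auto simp: inj_on_def card_Fq')
    moreover have "(\<lambda>x. x * a) ` Fq q \<subseteq> M" using cl that by auto
    ultimately show ?thesis by (simp add: card_Diff_subset)
  qed
  moreover have "{(a, b). a \<in> M \<and> b \<in> M \<and> indep a b} = (SIGMA a:M - {0}. {b \<in> M. indep a b})"
    using indep_nz by auto
  ultimately show ?thesis using assms(1) by (simp add: card_Diff_singleton)
qed

text \<open>The number of lines of \<open>PG(t - 1, q)\<close>, counted through their ordered bases.\<close>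

lemma card_span2_image:
  assumes inj: "\<And>a b c d. indep a b \<Longrightarrow> indep c d \<Longrightarrow> f a b = f c d \<longleftrightarrow> span2 a b = span2 c d"
  shows "card {f a b | a b. indep a b} * ((q\<^sup>2 - 1) * (q\<^sup>2 - q)) = (q ^ t - 1) * (q ^ t - q)"
proof -
  let ?B = "{(a, b). indep a b}"
  let ?S = "{f a b | a b. indep a b}"
  have "card ?B = (\<Sum>z\<in>?B. 1)" by simp
  \<comment> \<open>The independent pairs are sorted by their value under \<open>f\<close>; the
    fibre over \<open>f a b\<close> consists of the ordered bases of
    \<open>span2 a b\<close>.\<close>
  also have "\<dots> = (\<Sum>s\<in>(\<lambda>(a, b). f a b) ` ?B. \<Sum>z\<in>{z \<in> ?B. (\<lambda>(a, b). f a b) z = s}. 1)"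
    by (rule sum.image_gen) simp
  also have "(\<lambda>(a, b). f a b) ` ?B = ?S" by auto
  also have "(\<Sum>s\<in>?S. \<Sum>z\<in>{z \<in> ?B. (\<lambda>(a, b). f a b) z = s}. 1) = (\<Sum>s\<in>?S. (q\<^sup>2 - 1) * (q\<^sup>2 - q))"
  proof (rule sum.cong[OF refl])
    fix s assume "s \<in> ?S"
    then obtain a b where ab: "indep a b" "s = f a b" by auto
    have "{z \<in> ?B. (\<lambda>(a, b). f a b) z = s} = {(c, d). c \<in> span2 a b \<and> d \<in> span2 a b \<and> indep c d}"
    proof -
      have "f c d = f a b \<longleftrightarrow> c \<in> span2 a b \<and> d \<in> span2 a b" if "indep c d" for c d
        using inj[OF that ab(1)] span2_eq[OF ab(1) that] span2_base[of c d] span2_base[of d c] by auto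
      thus ?thesis using ab by auto
    qed
    also have "card \<dots> = (q\<^sup>2 - 1) * (q\<^sup>2 - q)"
    proof (subst card_indep_pairs)
      show "0 \<in> span2 a b"
        using span2_closed[OF span2_base(1)[of a b] span2_base(1), of 0 0] Fq_closed(3) by simp
      show "x * c \<in> span2 a b" if "x \<in> Fq q" "c \<in> span2 a b" for x c
        using span2_closed[OF that(2,2,1), of 0] Fq_closed(3) by simp
    qed (simp add: card_span2 ab)
    finally show "(\<Sum>z\<in>{z \<in> ?B. (\<lambda>(a, b). f a b) z = s}. 1) = (q\<^sup>2 - 1) * (q\<^sup>2 - q)" by simp
  qed
  also have "card ?B = (q ^ t - 1) * (q ^ t - q)"
    using card_indep_pairs[of UNIV] by (simp add: card_k)
  finally show ?thesis by simp
qed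

end

section \<open>Sublines in cyclic coordinates\<close>

lemma vec_linearI:
  fixes f :: "'k::field ^ 'm \<Rightarrow> 'k ^ 'n"
  assumes "\<And>x y. f (x + y) = f x + f y" "\<And>c x. f (c *s x) = c *s f x"
  shows "Vector_Spaces.linear (*s) (*s) f"
  using assms by (simp add: Vector_Spaces.linear_iff vec.vector_space_axioms)

lemma vector2_simps:
  "(vector [x, y] :: 'k::field ^ 2) = vector [x', y'] \<longleftrightarrow> x = x' \<and> y = y'"
  "c *s (vector [x, y] :: 'k ^ 2) = vector [c * x, c * y]"
  "(vector [x, y] :: 'k ^ 2) + vector [x', y'] = vector [x + x', y + y']"
  by (auto simp: vec_eq_iff forall_2)

text \<open>Turns an inclusion between sublines into an equality in
  \<open>subline_projection_base_curve\<close>.\<close>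

lemma card_subline_eq:
  fixes S S' :: "('k::field ^ 'n) set set"
  assumes "subline q l S" "subline q l' S'"
  shows "card S = card S'"
proof -
  have card: "card S = card {pt (vector [a, b] :: 'k ^ 2) | a b. a \<in> Fq q \<and> b \<in> Fq q \<and> (a, b) \<noteq> (0, 0)}"
    if "subline q l S" for l and S :: "('k ^ 'n) set set"
  proof -
    obtain \<phi> :: "'k ^ 2 \<Rightarrow> 'k ^ 'n" where "inj \<phi>"
      "S = (`) \<phi> ` {pt (vector [a, b]) | a b. a \<in> Fq q \<and> b \<in> Fq q \<and> (a, b) \<noteq> (0, 0)}"
      using \<open>subline q l S\<close> unfolding subline_def projectively_equivalent_def by blast
    moreover have "inj_on ((`) \<phi>) X" for X
      using \<open>inj \<phi>\<close> by (metis inj_image_eq_iff inj_onI)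
    ultimately show ?thesis by (simp only: card_image)
  qed
  show ?thesis using card[OF assms(1)] card[OF assms(2)] by simp
qed

lemma subline_two_points:
  fixes S :: "('k::field ^ 'n) set set"
  assumes "subline q l S" "q > 0"
  obtains X Y where "X \<in> S" "Y \<in> S" "X \<noteq> Y"
proof -
  obtain \<phi> :: "'k ^ 2 \<Rightarrow> 'k ^ 'n" where \<phi>: "inj \<phi>"
    "S = (`) \<phi> ` {pt (vector [a, b]) | a b. a \<in> Fq q \<and> b \<in> Fq q \<and> (a, b) \<noteq> (0, 0)}"
    using assms(1) unfolding subline_def projectively_equivalent_def by blast
  have F: "0 \<in> (Fq q :: 'k set)" "1 \<in> (Fq q :: 'k set)" using assms(2) by (auto simp: Fq_def)
  have "pt (vector [1, 0] :: 'k ^ 2) \<noteq> pt (vector [0, 1])"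
    by (auto dest!: pt_eqD simp: vector2_simps)
  hence "\<phi> ` pt (vector [1, 0]) \<noteq> \<phi> ` pt (vector [0, 1])"
    using \<phi>(1) by (simp add: inj_image_eq_iff)
  moreover have "\<phi> ` pt (vector [a, b]) \<in> S"
    if "a \<in> Fq q" "b \<in> Fq q" "(a, b) \<noteq> (0, 0)" for a b
    unfolding \<phi>(2) using that by blast
  note this[of 1 0] this[of 0 1]
  ultimately show ?thesis using that F by simp
qed

text \<open>\<open>T\<close> sends the unit vectors to the frame formed by \<open>P\<close> and its images under \<open>\<sigma>\<close>; the subgeometry
  then consists of the points \<open>pt (T (\<omega> a))\<close>, and \<open>\<iota>\<close> coordinatizes the line \<open>l\<close>.\<close>

locale normal_form = field_aut \<alpha> q t
  for \<alpha> :: "'k::{field,finite} \<Rightarrow> 'k" and q t +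
  fixes T :: "'k ^ 'n \<Rightarrow> 'k ^ 'n" and \<iota> :: "'k ^ 2 \<Rightarrow> 'k ^ 'n"
    and \<Gamma> l :: "('k ^ 'n) set" and \<omega> :: "'k \<Rightarrow> 'k ^ 'n"
  assumes card_n: "CARD('n) = t"
    and \<omega>_def: "\<omega> = (\<lambda>a. \<chi> i. (\<alpha> ^^ idx i) a)"
    and linear_T: "Vector_Spaces.linear (*s) (*s) T" and bij_T: "bij T"
    and linear_\<iota>: "Vector_Spaces.linear (*s) (*s) \<iota>" and inj_\<iota>: "inj \<iota>" and range_\<iota>: "range \<iota> = l"
    and projection_\<omega>: "a \<noteq> 0 \<Longrightarrow> vec.span (\<Gamma> \<union> pt (T (\<omega> a))) \<inter> l =
      pt (\<iota> (vector [(\<alpha> ^^ (t - 2)) a, (\<alpha> ^^ (t - 1)) a]))"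
begin

text \<open>By \<open>projection_\<omega>\<close> this is the projection of the subgeometry point
  with parameter \<open>a\<close>.\<close>

definition image_pt :: "'k \<Rightarrow> ('k ^ 'n) set" where
  "image_pt a = pt (\<iota> (vector [(\<alpha> ^^ (t - 2)) a, (\<alpha> ^^ (t - 1)) a]))"

text \<open>As \<open>c\<close> runs through \<open>span2 a b\<close>, the parameters
  \<open>c\<close> form a line of the subgeometry; the parameters \<open>1 / c\<close> form its
  image under coordinatewise inversion, which is then projected.\<close>

definition line_image :: "'k \<Rightarrow> 'k \<Rightarrow> ('k ^ 'n) set set" where
  "line_image a b = {image_pt (1 / c) | c. c \<in> span2 a b - {0}}"

lemma \<omega>_nth [simp]: "\<omega> a $ i = (\<alpha> ^^ idx i) a"
  by (simp add: \<omega>_def)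

lemma q_pos: "q > 0"
  using card_Fq' card_mono[of "Fq q" "{0 :: 'k}"] Fq_closed(3) by (cases "q = 0") auto

lemma projection_sub:
  "projection \<Gamma> l {pt (T (\<omega> a)) | a. a \<in> X \<and> a \<noteq> 0} = {image_pt a | a. a \<in> X \<and> a \<noteq> 0}"
proof -
  note image = projection_\<omega>[folded image_pt_def]
  have "projection \<Gamma> l {pt (T (\<omega> a)) | a. a \<in> X \<and> a \<noteq> 0} =
      {vec.span (\<Gamma> \<union> pt (T (\<omega> a))) \<inter> l | a. a \<in> X \<and> a \<noteq> 0}"
    unfolding projection_def by blast
  also have "\<dots> = {image_pt a | a. a \<in> X \<and> a \<noteq> 0}"
    by (rule Collect_cong, rule ex_cong1, rule iffI; simp add: image)
  finally show ?thesis .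
qed

text \<open>Proportionality of the coordinate pairs says that two consecutive iterates of
  \<open>\<alpha>\<close> agree at \<open>a / b\<close>; cancelling the smaller one leaves
  \<open>\<alpha> (a / b) = a / b\<close>. So the projection is injective on the
  subgeometry.\<close>

lemma image_pt_eq_iff:
  assumes "a \<noteq> 0" "b \<noteq> 0"
  shows "image_pt a = image_pt b \<longleftrightarrow> a / b \<in> Fq q"
proof
  assume "image_pt a = image_pt b"
  then obtain c where "\<iota> (vector [(\<alpha> ^^ (t - 2)) a, (\<alpha> ^^ (t - 1)) a]) =
      c *s \<iota> (vector [(\<alpha> ^^ (t - 2)) b, (\<alpha> ^^ (t - 1)) b])"
    unfolding image_pt_def by (auto dest: pt_eqD)
  hence "(vector [(\<alpha> ^^ (t - 2)) a, (\<alpha> ^^ (t - 1)) a] :: 'k ^ 2) =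
      c *s vector [(\<alpha> ^^ (t - 2)) b, (\<alpha> ^^ (t - 1)) b]"
    using inj_\<iota> by (simp add: inj_eq flip: vec.linear_scale[OF linear_\<iota>])
  hence "(\<alpha> ^^ (t - 2)) (a / b) = c" "(\<alpha> ^^ (t - 1)) (a / b) = c"
    using assms by (simp_all add: vector2_simps funpow_hom)
  moreover have "t - 1 = Suc (t - 2)" using t_ge by simp
  ultimately have "(\<alpha> ^^ Suc (t - 2)) (a / b) = (\<alpha> ^^ (t - 2)) (a / b)" by metis
  thus "a / b \<in> Fq q" by (simp only: funpow_Suc_right comp_apply funpow_eq_iff fixed_iff)
next
  assume F: "a / b \<in> Fq q"
  have "(\<alpha> ^^ n) a = a / b * (\<alpha> ^^ n) b" for n
    using funpow_Fq[OF F, of n] assms by (simp add: funpow_hom divide_simps)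
  hence "image_pt a = pt ((a / b) *s \<iota> (vector [(\<alpha> ^^ (t - 2)) b, (\<alpha> ^^ (t - 1)) b]))"
    unfolding image_pt_def by (simp only: vector2_simps flip: vec.linear_scale[OF linear_\<iota>])
  moreover have "a / b \<noteq> 0" using assms by simp
  ultimately show "image_pt a = image_pt b" by (simp only: pt_scale image_pt_def not_False_eq_True)
qed

lemma image_pt_mem_line_image_iff:
  assumes "c \<noteq> 0"
  shows "image_pt (1 / c) \<in> line_image a b \<longleftrightarrow> c \<in> span2 a b"
proof
  assume "image_pt (1 / c) \<in> line_image a b"
  then obtain d where d: "d \<in> span2 a b" "d \<noteq> 0" "image_pt (1 / c) = image_pt (1 / d)"
    unfolding line_image_def by auto
  hence "c / d \<in> Fq q" using assms image_pt_eq_iff[of "1 / d" "1 / c"] by simp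
  thus "c \<in> span2 a b"
    using span2_closed[OF d(1,1), of "c / d" 0] Fq_closed(3) d(2) by simp
qed (use assms in \<open>auto simp: line_image_def\<close>)

lemma line_image_eq_iff:
  assumes "indep a b" "indep c d"
  shows "line_image a b = line_image c d \<longleftrightarrow> span2 a b = span2 c d"
proof
  assume "line_image a b = line_image c d"
  hence "a \<in> span2 c d" "b \<in> span2 c d"
    using image_pt_mem_line_image_iff indep_nz[OF assms(1)] span2_base by metis+
  thus "span2 a b = span2 c d" using span2_eq assms by blast
qed (simp add: line_image_def)

lemma subline_line_image:
  assumes ind: "indep a b"
  shows "subline q l (line_image a b)"
proof -
  define u v u' v' where "u = (\<alpha> ^^ (t - 1)) a" and "v = (\<alpha> ^^ (t - 1)) b"
    and "u' = (\<alpha> ^^ (t - 2)) a" and "v' = (\<alpha> ^^ (t - 2)) b"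
  \<comment> \<open>The linear extension to the large field of the \<open>Fq q\<close>-linear map
    sending \<open>(x, y)\<close> to the conjugates of exponents \<open>t - 1\<close> and
    \<open>t - 2\<close> of \<open>x * a + y * b\<close>.\<close>
  define \<psi> :: "'k ^ 2 \<Rightarrow> 'k ^ 2" where
    "\<psi> w = vector [w $ 1 * u + w $ 2 * v, w $ 1 * u' + w $ 2 * v']" for w
  have lin: "Vector_Spaces.linear (*s) (*s) \<psi>"
    by (rule vec_linearI) (simp_all add: \<psi>_def vector2_simps algebra_simps)
  have det: "u * v' \<noteq> v * u'"
    using indep_funpow[OF ind, of "t - 1" "t - 2"] t_ge by (simp add: u_def v_def u'_def v'_def mult.commute)
  have "inj \<psi>"
  proof (subst vec.linear_inj_iff_eq_0[OF lin], intro allI impI)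
    fix w assume "\<psi> w = 0"
    hence "\<psi> w $ 1 = 0" "\<psi> w $ 2 = 0" by simp_all
    hence "w $ 1 * u + w $ 2 * v = 0" "w $ 1 * u' + w $ 2 * v' = 0" by (simp_all add: \<psi>_def)
    with det have "w $ 1 = 0 \<and> w $ 2 = 0" by (intro det2_nz_imp_zero)
    thus "w = 0" by (simp add: vec_eq_iff forall_2)
  qed
  hence "surj \<psi>" using vec.linear_inj_imp_surj[OF lin] by blast
  define \<phi> where "\<phi> = \<iota> \<circ> \<psi>"
  have "Vector_Spaces.linear (*s) (*s) \<phi>" unfolding \<phi>_def
    using lin linear_\<iota> by (rule Vector_Spaces.linear_compose)
  moreover have "inj \<phi>" unfolding \<phi>_def using inj_\<iota> \<open>inj \<psi>\<close> by (rule inj_compose)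
  moreover have "range \<phi> = l" unfolding \<phi>_def using range_\<iota> \<open>surj \<psi>\<close> by (metis image_comp)
  moreover have "line_image a b =
      (`) \<phi> ` {pt (vector [x, y]) | x y. x \<in> Fq q \<and> y \<in> Fq q \<and> (x, y) \<noteq> (0, 0)}"
  proof -
    have nz: "x * a + y * b \<noteq> 0 \<longleftrightarrow> (x, y) \<noteq> (0, 0)" if "x \<in> Fq q" "y \<in> Fq q" for x y
    proof -
      have "x = 0 \<and> y = 0" if "x * a + y * b = 0"
      proof (rule det2_nz_imp_zero[OF that])
        show "x * \<alpha> a + y * \<alpha> b = 0"
          using arg_cong[OF that, of \<alpha>] \<open>x \<in> Fq q\<close> \<open>y \<in> Fq q\<close> by (simp flip: fixed_iff)
        show "a * \<alpha> b \<noteq> b * \<alpha> a" using ind by (simp add: indep_def)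
      qed
      thus ?thesis by auto
    qed
    have image: "image_pt (1 / (x * a + y * b)) = \<phi> ` pt (vector [x, y])"
      if "x \<in> Fq q" "y \<in> Fq q" "(x, y) \<noteq> (0, 0)" for x y
    proof -
      let ?c = "x * a + y * b"
      have c: "?c \<noteq> 0" using nz that by simp
      have "\<psi> (vector [x, y]) = vector [(\<alpha> ^^ (t - 1)) ?c, (\<alpha> ^^ (t - 2)) ?c]"
        using that(1,2) by (simp add: \<psi>_def span2_funpow u_def v_def u'_def v'_def)
      \<comment> \<open>Multiplying by both conjugates of \<open>?c\<close> clears the denominators
        and exchanges the two entries.\<close>
      also have "\<dots> = ((\<alpha> ^^ (t - 1)) ?c * (\<alpha> ^^ (t - 2)) ?c) *s
          vector [(\<alpha> ^^ (t - 2)) (1 / ?c), (\<alpha> ^^ (t - 1)) (1 / ?c)]"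
        unfolding vector2_simps(1,2) funpow_hom(3,4) using c by simp
      finally have "\<phi> (vector [x, y]) = ((\<alpha> ^^ (t - 1)) ?c * (\<alpha> ^^ (t - 2)) ?c) *s
          \<iota> (vector [(\<alpha> ^^ (t - 2)) (1 / ?c), (\<alpha> ^^ (t - 1)) (1 / ?c)])"
        by (simp add: \<phi>_def vec.linear_scale[OF linear_\<iota>])
      moreover have "(\<alpha> ^^ (t - 1)) ?c * (\<alpha> ^^ (t - 2)) ?c \<noteq> 0" using c by simp
      ultimately show ?thesis
        unfolding linear_image_pt[OF \<open>Vector_Spaces.linear (*s) (*s) \<phi>\<close>] image_pt_def by (simp only: pt_scale not_False_eq_True)
    qed
    have "line_image a b = {image_pt (1 / (x * a + y * b)) | x y. x \<in> Fq q \<and> y \<in> Fq q \<and> (x, y) \<noteq> (0, 0)}"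
      unfolding line_image_def span2_def using nz by blast
    also have "\<dots> = {\<phi> ` pt (vector [x, y]) | x y. x \<in> Fq q \<and> y \<in> Fq q \<and> (x, y) \<noteq> (0, 0)}"
      using image by blast
    finally show ?thesis by (simp only: setcompr_eq_image) blast
  qed
  ultimately show ?thesis
    unfolding subline_def projectively_equivalent_def by blast
qed

section \<open>Curves through the frame points and their projections\<close>

abbreviation Sub :: "('k ^ 'n) set set" where
  "Sub \<equiv> {pt (T (\<omega> a)) | a. a \<noteq> 0}"

abbreviation base_curve :: "('k ^ 'n) set set \<Rightarrow> bool" where
  "base_curve C \<equiv> normal_rational_curve C \<and> (\<forall>i. pt (T (axis i 1)) \<in> C)"

lemma \<omega>_combination:
  assumes "indep a b"
    and "\<And>i. (\<alpha> ^^ idx i) c = x * (\<alpha> ^^ idx (i :: 'n)) a + y * (\<alpha> ^^ idx i) b"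
  shows "c \<in> span2 a b"
proof (rule combination_in_span2[OF assms(1)])
  fix j assume "j < t"
  then obtain i :: 'n where "idx i = j" using ex_idx card_n by metis
  thus "(\<alpha> ^^ j) c = x * (\<alpha> ^^ j) a + y * (\<alpha> ^^ j) b" using assms(2)[of i] by simp
qed

text \<open>The curve is that of \<open>nrc_of_pencil\<close> for the conjugates of \<open>a\<close>
  and \<open>b\<close>. Inverting the coordinates of \<open>\<omega> (1 / c)\<close> gives the
  conjugates of \<open>c\<close>, so the point lies on the curve iff these are a combination of the
  conjugates of \<open>a\<close> and \<open>b\<close>, which by \<open>\<omega>_combination\<close>
  means \<open>c \<in> span2 a b\<close>.\<close>

lemma exists_base_curve:
  assumes ind: "indep a b"
  obtains C where "base_curve C" "projection \<Gamma> l (C \<inter> Sub) = line_image a b"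
proof -
  define A B where "A i = (\<alpha> ^^ idx i) a" and "B i = (\<alpha> ^^ idx i) b" for i :: 'n
  have A: "A i \<noteq> 0" for i using indep_nz[OF ind] by (simp add: A_def)
  have AB: "A i * B j \<noteq> A j * B i" if "i \<noteq> j" for i j
    unfolding A_def B_def using that idx_less[where ?'n = 'n]
    by (intro indep_funpow[OF ind]) (auto simp: idx_eq_iff card_n[symmetric])
  obtain \<phi> :: "'k ^ 'n \<Rightarrow> 'k ^ 'n" where \<phi>: "Vector_Spaces.linear (*s) (*s) \<phi>" "bij \<phi>"
    and mom: "\<And>y i. \<phi> (moment y) $ i = (\<Prod>j\<in>UNIV-{i}. A j * y + B j)"
    and inf: "\<And>i. \<phi> moment_inf $ i = (\<Prod>j\<in>UNIV-{i}. A j)"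
    and base: "\<And>i. pt (axis i 1) \<in> (`) \<phi> ` standard_nrc"
    by (rule nrc_of_pencil[of A B, OF A]) (rule AB, assumption, rule that)
  have other: "\<exists>j. j \<noteq> i" for i :: 'n
    using ex_other_index[where ?'n = 'n] card_n t_ge by simp
  have nrc_iff: "pt (\<omega> (1 / c)) \<in> (`) \<phi> ` standard_nrc \<longleftrightarrow> c \<in> span2 a b" if c: "c \<noteq> 0" for c
  proof
    assume "pt (\<omega> (1 / c)) \<in> (`) \<phi> ` standard_nrc"
    then obtain x where x: "pt (\<omega> (1 / c)) = \<phi> ` pt x" "(\<exists>y. x = moment y) \<or> x = moment_inf"
      unfolding standard_nrc_def by auto
    from x(1) obtain k where k: "\<phi> x = k *s \<omega> (1 / c)"
      using pt_eqD[of "\<phi> x" "\<omega> (1 / c)"] by (metis linear_image_pt[OF \<phi>(1)])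
    have "x \<noteq> 0"
    proof
      assume "x = 0"
      hence "\<omega> (1 / c) = 0" using x(1) pt_eqD[of "\<omega> (1 / c)" "\<phi> x"]
        by (auto simp: linear_image_pt[OF \<phi>(1)] vec.linear_0[OF \<phi>(1)])
      hence "\<omega> (1 / c) $ undefined = 0" by simp
      with c show False by simp
    qed
    hence "\<phi> x \<noteq> 0" using \<phi> by (metis bij_is_inj injD vec.linear_0)
    hence k0: "k \<noteq> 0" using k by auto
    \<comment> \<open>Homogeneous parameters: \<open>(y, 1)\<close> for a finite point and
      \<open>(1, 0)\<close> for the point at infinity.\<close>
    from x(2) obtain r s where rs: "\<And>i. \<phi> x $ i = (\<Prod>j\<in>UNIV-{i}. r * A j + s * B j)"
    proof
      assume "\<exists>y. x = moment y"
      then obtain y where "x = moment y" by blast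
      thus ?thesis using that[of y 1] mom by (simp add: mult.commute)
    next
      assume "x = moment_inf"
      thus ?thesis using that[of 1 0] inf by simp
    qed
    define G where "G = (\<Prod>j\<in>UNIV. r * A j + s * B j)"
    have nz: "\<phi> x $ i \<noteq> 0" for i using k k0 c by simp
    have "r * A j + s * B j \<noteq> 0" for j
    proof -
      obtain i where "i \<noteq> j" using other by blast
      thus ?thesis using nz[of i] unfolding rs by auto
    qed
    hence G: "G \<noteq> 0" by (simp add: G_def)
    have "(\<alpha> ^^ idx i) c = (k * r / G) * (\<alpha> ^^ idx i) a + (k * s / G) * (\<alpha> ^^ idx i) b" for i :: 'n
    proof -
      have "G = (r * A i + s * B i) * \<phi> x $ i" unfolding G_def rs by (rule prod.remove) auto
      also have "\<phi> x $ i = k / (\<alpha> ^^ idx i) c" by (simp add: k funpow_hom)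
      finally have "G * (\<alpha> ^^ idx i) c = (r * A i + s * B i) * k" using c by (simp add: field_simps)
      thus ?thesis using G by (simp add: A_def B_def field_simps)
    qed
    thus "c \<in> span2 a b" by (rule \<omega>_combination[OF ind])
  next
    assume "c \<in> span2 a b"
    then obtain x y where xy: "x \<in> Fq q" "y \<in> Fq q" "c = x * a + y * b"
      by (auto simp: span2_def)
    hence ci: "(\<alpha> ^^ idx i) c = x * A i + y * B i" for i :: 'n
      by (simp add: span2_funpow A_def B_def)
    define N where "N = (\<Prod>j\<in>UNIV. x * A (j :: 'n) + y * B j)"
    have N: "N \<noteq> 0" using c by (auto simp: N_def simp flip: ci)
    have Ni: "(\<Prod>j\<in>UNIV-{i}. x * A j + y * B j) = N * (\<alpha> ^^ idx i) (1 / c)" for i :: 'n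
    proof -
      have "N = (\<alpha> ^^ idx i) c * (\<Prod>j\<in>UNIV-{i}. x * A j + y * B j)"
        unfolding N_def ci by (rule prod.remove) auto
      thus ?thesis using c by (simp add: funpow_hom)
    qed
    \<comment> \<open>The parameter is \<open>x / y\<close>, or infinity if \<open>y = 0\<close>.
      The power \<open>t - 1\<close> comes from extracting a scalar from each of the
      \<open>t - 1\<close> factors.\<close>
    have "\<exists>z d. d \<noteq> 0 \<and> \<phi> z = d *s \<omega> (1 / c) \<and> ((\<exists>y. z = moment y) \<or> z = moment_inf)"
    proof (cases "y = 0")
      case True
      have "(\<Prod>j\<in>UNIV-{i}. x * A j) = x ^ (t - 1) * (\<Prod>j\<in>UNIV-{i}. A j)" for i
        by (simp add: prod.distrib card_Diff_singleton card_n)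
      hence "\<phi> moment_inf $ i = N / x ^ (t - 1) * \<omega> (1 / c) $ i" for i
        using Ni[of i] True xy c by (simp add: inf field_simps del: One_nat_def)
      hence "\<phi> moment_inf = (N / x ^ (t - 1)) *s \<omega> (1 / c)" by (simp add: vec_eq_iff)
      moreover have "N / x ^ (t - 1) \<noteq> 0" using N True xy c by auto
      ultimately show ?thesis by blast
    next
      case False
      have "(\<Prod>j\<in>UNIV-{i}. x * A j + y * B j) = y ^ (t - 1) * (\<Prod>j\<in>UNIV-{i}. A j * (x / y) + B j)" for i
      proof -
        have "(\<Prod>j\<in>UNIV-{i}. x * A j + y * B j) = (\<Prod>j\<in>UNIV-{i}. y * (A j * (x / y) + B j))"
          using False by (simp add: algebra_simps)
        thus ?thesis by (simp add: prod.distrib card_Diff_singleton card_n)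
      qed
      hence "\<phi> (moment (x / y)) $ i = N / y ^ (t - 1) * \<omega> (1 / c) $ i" for i
        unfolding mom using Ni[of i] False by (simp add: eq_divide_eq mult.commute del: One_nat_def)
      hence "\<phi> (moment (x / y)) = (N / y ^ (t - 1)) *s \<omega> (1 / c)" by (simp add: vec_eq_iff)
      moreover have "N / y ^ (t - 1) \<noteq> 0" using N False by simp
      ultimately show ?thesis by blast
    qed
    then obtain z d where z: "d \<noteq> 0" "\<phi> z = d *s \<omega> (1 / c)" "(\<exists>y. z = moment y) \<or> z = moment_inf"
      by blast
    have "pt z \<in> standard_nrc" using z(3) unfolding standard_nrc_def by blast
    moreover have "pt (\<omega> (1 / c)) = \<phi> ` pt z" using z(1,2) by (simp add: linear_image_pt[OF \<phi>(1)] pt_scale)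
    ultimately show "pt (\<omega> (1 / c)) \<in> (`) \<phi> ` standard_nrc" by blast
  qed
  define C where "C = (`) (T \<circ> \<phi>) ` standard_nrc"
  have "normal_rational_curve C"
    unfolding normal_rational_curve_def projectively_equivalent_def C_def
    using Vector_Spaces.linear_compose[OF \<phi>(1) linear_T] bij_comp[OF \<phi>(2) bij_T]
    by (intro exI[of _ "T \<circ> \<phi>"]) (simp add: bij_is_inj bij_is_surj del: o_apply)
  have C: "pt (T x) \<in> C \<longleftrightarrow> pt x \<in> (`) \<phi> ` standard_nrc" for x
  proof -
    have "C = (`) T ` ((`) \<phi> ` standard_nrc)" by (simp add: C_def image_comp)
    moreover have "inj ((`) T)" using bij_T by (meson bij_is_inj inj_image_eq_iff injI)
    ultimately show ?thesis
      by (simp add: inj_image_mem_iff flip: linear_image_pt[OF linear_T])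
  qed
  have "base_curve C" using \<open>normal_rational_curve C\<close> C base by blast
  \<comment> \<open>The element \<open>c = 0\<close> of the span contributes
    \<open>1 / 0 = 0\<close>, which the condition \<open>d \<noteq> 0\<close> removes.\<close>
  have "C \<inter> Sub = {pt (T (\<omega> d)) | d. d \<in> {1 / c | c. c \<in> span2 a b} \<and> d \<noteq> 0}"
  proof -
    have "pt (T (\<omega> d)) \<in> C \<longleftrightarrow> d \<in> {1 / c | c. c \<in> span2 a b}" if "d \<noteq> 0" for d
    proof -
      have "pt (T (\<omega> d)) \<in> C \<longleftrightarrow> 1 / d \<in> span2 a b"
        using nrc_iff[of "1 / d"] C[of "\<omega> d"] that by simp
      thus ?thesis by force
    qed
    thus ?thesis by blast
  qed
  hence "projection \<Gamma> l (C \<inter> Sub) = {image_pt d | d. d \<in> {1 / c | c. c \<in> span2 a b} \<and> d \<noteq> 0}"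
    by (simp only: projection_sub)
  also have "\<dots> = line_image a b"
  proof (rule subset_antisym; rule subsetI)
    fix X assume "X \<in> line_image a b"
    then obtain c where "X = image_pt (1 / c)" "c \<in> span2 a b" "1 / c \<noteq> 0"
      by (auto simp: line_image_def)
    thus "X \<in> {image_pt d | d. d \<in> {1 / c | c. c \<in> span2 a b} \<and> d \<noteq> 0}" by blast
  next
    fix X assume "X \<in> {image_pt d | d. d \<in> {1 / c | c. c \<in> span2 a b} \<and> d \<noteq> 0}"
    then obtain c where "X = image_pt (1 / c)" "c \<in> span2 a b" "1 / c \<noteq> 0" by blast
    moreover from this have "c \<noteq> 0" by auto
    ultimately show "X \<in> line_image a b" unfolding line_image_def by blast
  qed
  finally have "projection \<Gamma> l (C \<inter> Sub) = line_image a b" .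
  with \<open>base_curve C\<close> show ?thesis by (rule that)
qed

text \<open>By \<open>inverse_nrc_in_pencil\<close> the conjugate vectors belonging to points of
  \<open>S\<close> lie in a two-dimensional space. Two distinct points give independent
  \<open>a\<close> and \<open>b\<close> whose conjugates span it, so
  \<open>S \<subseteq> line_image a b\<close>, and both are sublines of the same finite
  size.\<close>

lemma subline_projection_base_curve:
  assumes curve: "base_curve C" and S: "subline q l S" "S = projection \<Gamma> l (C \<inter> Sub)"
  obtains a b where "indep a b" "S = line_image a b"
proof -
  obtain \<phi>' :: "'k ^ 'n \<Rightarrow> 'k ^ 'n" where \<phi>': "Vector_Spaces.linear (*s) (*s) \<phi>'" "inj \<phi>'"
      "C = (`) \<phi>' ` standard_nrc"
    using curve unfolding normal_rational_curve_def projectively_equivalent_def by blast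
  \<comment> \<open>Undoing \<open>T\<close> moves the frame points to the unit points, as
    \<open>inverse_nrc_in_pencil\<close> requires.\<close>
  obtain T' where T': "Vector_Spaces.linear (*s) (*s) T'" "T' \<circ> T = id"
    using vec.linear_injective_left_inverse[OF linear_T bij_is_inj[OF bij_T]] by blast
  define \<phi> where "\<phi> = T' \<circ> \<phi>'"
  have T'T: "T' (T x) = x" for x using T'(2) by (rule pointfree_idE)
  have "inj T'"
  proof (rule injI)
    fix x y assume "T' x = T' y"
    moreover obtain u v where "x = T u" "y = T v" using bij_is_surj[OF bij_T] by (metis surjD)
    ultimately show "x = y" by (simp add: T'T)
  qed
  have lin: "Vector_Spaces.linear (*s) (*s) \<phi>"
    unfolding \<phi>_def using \<phi>'(1) T'(1) by (rule Vector_Spaces.linear_compose)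
  have inj: "inj \<phi>" unfolding \<phi>_def using \<open>inj T'\<close> \<phi>'(2) by (rule inj_compose)
  have C: "pt x \<in> (`) \<phi> ` standard_nrc" if x: "pt (T x) \<in> C" for x
  proof -
    have "T' ` pt (T x) = pt x"
      by (simp add: linear_image_pt[OF T'(1)] T'T)
    moreover obtain X where "X \<in> standard_nrc" "pt (T x) = \<phi>' ` X" using x \<phi>'(3) by blast
    ultimately show ?thesis by (metis \<phi>_def image_comp imageI)
  qed
  have base: "pt (axis i 1) \<in> (`) \<phi> ` standard_nrc" for i using C curve by blast
  have n2: "CARD('n) \<ge> 2" using card_n t_ge by simp
  obtain g h where gh: "\<forall>z. pt z \<in> (`) \<phi> ` standard_nrc \<longrightarrow> (\<forall>i. z $ i \<noteq> 0) \<longrightarrow>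
       (\<exists>r s. \<forall>i. inverse (z $ i) = r * g i + s * h i)"
    using inverse_nrc_in_pencil[OF n2 lin inj base] by blast
  have "C \<inter> Sub = {pt (T (\<omega> a)) | a. a \<in> {a. pt (T (\<omega> a)) \<in> C} \<and> a \<noteq> 0}" by blast
  hence S_eq: "S = {image_pt a | a. a \<in> {a. pt (T (\<omega> a)) \<in> C} \<and> a \<noteq> 0}"
    by (simp only: S(2) projection_sub)
  have pencil: "\<exists>c r s. c \<noteq> 0 \<and> X = image_pt (1 / c) \<and> (\<forall>i. (\<alpha> ^^ idx i) c = r * g i + s * h i)"
    if "X \<in> S" for X
  proof -
    obtain d where d: "X = image_pt d" "pt (T (\<omega> d)) \<in> C" "d \<noteq> 0" using \<open>X \<in> S\<close> S_eq by blast
    have "\<exists>r s. \<forall>i. inverse (\<omega> d $ i) = r * g i + s * h i"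
      using gh[rule_format, OF C[OF d(2)]] d(3) by simp
    then obtain r s where "\<And>i. inverse (\<omega> d $ i) = r * g i + s * h i" by blast
    hence "(\<alpha> ^^ idx i) (1 / d) = r * g i + s * h i" for i
      by (simp add: funpow_hom inverse_eq_divide)
    moreover have "1 / d \<noteq> 0" "X = image_pt (1 / (1 / d))" using d by simp_all
    ultimately show ?thesis by blast
  qed
  obtain X Y where XY: "X \<in> S" "Y \<in> S" "X \<noteq> Y" using subline_two_points[OF S(1) q_pos] by blast
  obtain a r1 s1 where a: "a \<noteq> 0" "X = image_pt (1 / a)" "\<And>i. (\<alpha> ^^ idx i) a = r1 * g i + s1 * h i"
    using pencil[OF XY(1)] by blast
  obtain b r2 s2 where b: "b \<noteq> 0" "Y = image_pt (1 / b)" "\<And>i. (\<alpha> ^^ idx i) b = r2 * g i + s2 * h i"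
    using pencil[OF XY(2)] by blast
  have ind: "indep a b"
    using XY(3) a b not_indep_iff[of a b] image_pt_eq_iff[of "1 / a" "1 / b"] by auto
  obtain i0 i1 :: 'n where i01: "idx i0 = 0" "idx i1 = 1"
    using ex_idx[where ?'n = 'n, of 0] ex_idx[where ?'n = 'n, of 1] card_n t_ge by auto
  \<comment> \<open>The determinant expressing the conjugates of \<open>a\<close> and
    \<open>b\<close> through \<open>g\<close> and \<open>h\<close>. It divides the determinant in
    \<open>indep a b\<close>, so it is nonzero.\<close>
  define D where "D = r1 * s2 - r2 * s1"
  have "a * \<alpha> b - b * \<alpha> a = D * (g i0 * h i1 - g i1 * h i0)"
    using a(3)[of i0] a(3)[of i1] b(3)[of i0] b(3)[of i1] unfolding i01
    by (simp add: D_def algebra_simps)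
  hence D: "D \<noteq> 0" using ind by (auto simp: indep_def)
  have "S \<subseteq> line_image a b"
  proof
    fix Z assume "Z \<in> S"
    then obtain c r s where c: "c \<noteq> 0" "Z = image_pt (1 / c)" "\<And>i. (\<alpha> ^^ idx i) c = r * g i + s * h i"
      using pencil by blast
    \<comment> \<open>Cramer's rule for the change from \<open>g\<close>, \<open>h\<close> to the
      conjugates of \<open>a\<close>, \<open>b\<close>.\<close>
    have "(\<alpha> ^^ idx i) c = ((r * s2 - r2 * s) / D) * (\<alpha> ^^ idx i) a + ((r1 * s - r * s1) / D) * (\<alpha> ^^ idx i) b" for i :: 'n
    proof -
      have eq: "(r * s2 - r2 * s) * (r1 * g i + s1 * h i) + (r1 * s - r * s1) * (r2 * g i + s2 * h i) =
          D * (r * g i + s * h i)" by (simp add: D_def algebra_simps)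
      show ?thesis
        unfolding a(3) b(3) c(3) times_divide_eq_left add_divide_distrib[symmetric] eq
        using D by simp
    qed
    hence "c \<in> span2 a b" by (rule \<omega>_combination[OF ind])
    thus "Z \<in> line_image a b" using c by (simp add: image_pt_mem_line_image_iff)
  qed
  hence "S = line_image a b"
    using card_subline_eq[OF S(1) subline_line_image[OF ind]] by (intro card_subset_eq) auto
  with ind show ?thesis by (rule that)
qed

theorem card_sublines:
  "card {S. subline q l S \<and> S \<subseteq> projection \<Gamma> l Sub \<and>
      (\<exists>C. base_curve C \<and> S = projection \<Gamma> l (C \<inter> Sub))} * ((q\<^sup>2 - 1) * (q\<^sup>2 - q)) =
   (q ^ t - 1) * (q ^ t - q)"
proof -
  have "{S. subline q l S \<and> S \<subseteq> projection \<Gamma> l Sub \<and>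
      (\<exists>C. base_curve C \<and> S = projection \<Gamma> l (C \<inter> Sub))} = {line_image a b | a b. indep a b}"
    (is "?L = ?R")
  proof
    show "?L \<subseteq> ?R"
    proof
      fix S assume "S \<in> ?L"
      then obtain C where C: "subline q l S" "base_curve C" "S = projection \<Gamma> l (C \<inter> Sub)" by blast
      obtain a b where "indep a b" "S = line_image a b"
        by (rule subline_projection_base_curve[OF C(2,1,3)])
      thus "S \<in> ?R" by blast
    qed
    show "?R \<subseteq> ?L"
    proof
      fix S assume "S \<in> ?R"
      then obtain a b where ab: "indep a b" "S = line_image a b" by blast
      obtain C where C: "base_curve C" "projection \<Gamma> l (C \<inter> Sub) = line_image a b"
        by (rule exists_base_curve[OF ab(1)])
      have "S \<subseteq> projection \<Gamma> l Sub" unfolding ab(2) C(2)[symmetric] projection_def by blast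
      thus "S \<in> ?L" using subline_line_image[OF ab(1)] C unfolding ab(2) by blast
    qed
  qed
  thus ?thesis using card_span2_image[OF line_image_eq_iff] by simp
qed

end

section \<open>Canonical subgeometries and their stabilizers\<close>

lemma linear_bij_eq_0_iff:
  fixes f :: "'k::field ^ 'm \<Rightarrow> 'k ^ 'n"
  assumes "Vector_Spaces.linear (*s) (*s) f" "bij f"
  shows "f x = 0 \<longleftrightarrow> x = 0"
  using vec.linear_0[OF assms(1)] bij_is_inj[OF assms(2)] by (metis injD)

lemma points_in_UNIV_iff: "X \<in> points_in UNIV \<longleftrightarrow> (\<exists>v. v \<noteq> 0 \<and> X = pt v)"
  for X :: "('k::field ^ 'n) set"
proof
  assume "X \<in> points_in UNIV"
  hence X: "vec.subspace X" "vec.dim X = 1" by (auto simp: points_in_def proj_subspace_def)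
  obtain B where B: "B \<subseteq> X" "vec.independent B" "X \<subseteq> vec.span B" "card B = vec.dim X"
    using vec.basis_exists by blast
  then obtain v where "B = {v}" using X(2) by (metis card_1_singletonE)
  moreover from this B(2) have "v \<noteq> 0" by (metis insertI1 vec.dependent_zero)
  moreover have "X = vec.span B" using B X(1) by (metis subset_antisym vec.span_minimal)
  ultimately show "\<exists>v. v \<noteq> 0 \<and> X = pt v" by blast
next
  assume "\<exists>v. v \<noteq> 0 \<and> X = pt v"
  then obtain v where "v \<noteq> 0" "X = pt v" by blast
  moreover have "vec.independent {v}" using \<open>v \<noteq> 0\<close> by simp
  hence "vec.dim (pt v) = card {v}" by (subst vec.dim_span) (rule vec.dim_eq_card_independent)
  ultimately show "X \<in> points_in UNIV" by (simp add: points_in_def proj_subspace_def)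
qed

lemma semilinear_image_pt:
  assumes "semilinear_bij f"
  shows "f ` pt v = pt (f v)"
proof -
  obtain \<alpha> where \<alpha>: "field_automorphism \<alpha>" "\<And>c v. f (c *s v) = \<alpha> c *s f v"
    using assms by (auto simp: semilinear_bij_def)
  have surj: "surj \<alpha>" using \<alpha>(1) by (simp add: field_automorphism_def bij_is_surj)
  have "f ` range (\<lambda>k. k *s v) = range (\<lambda>k. \<alpha> k *s f v)" by (simp add: image_image \<alpha>(2))
  also have "\<dots> = (\<lambda>k. k *s f v) ` range \<alpha>" by (simp add: image_image)
  finally show ?thesis by (simp add: vec.span_singleton surj)
qed

lemma semilinear_eq_0:
  assumes "semilinear_bij f"
  shows "f v = 0 \<longleftrightarrow> v = 0"
proof -
  have "f (0 + 0) = f 0 + f 0" using assms unfolding semilinear_bij_def by blast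
  hence "f 0 = 0" by simp
  moreover have "inj f" using assms by (simp add: semilinear_bij_def bij_is_inj)
  ultimately show ?thesis by (metis injD)
qed

lemma collineation_in_Bij:
  fixes f :: "'k::{field,finite} ^ 'n \<Rightarrow> 'k ^ 'n"
  assumes "semilinear_bij f"
  shows "restrict ((`) f) (points_in UNIV) \<in> Bij (points_in UNIV)"
proof -
  have "(`) f ` points_in UNIV \<subseteq> points_in UNIV"
  proof (rule image_subsetI)
    fix X :: "('k ^ 'n) set" assume "X \<in> points_in UNIV"
    then obtain v where "v \<noteq> 0" "X = pt v" by (auto simp: points_in_UNIV_iff)
    hence "f v \<noteq> 0" "f ` X = pt (f v)"
      using semilinear_image_pt[OF assms] semilinear_eq_0[OF assms] by simp_all
    thus "f ` X \<in> points_in UNIV" by (auto simp: points_in_UNIV_iff)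
  qed
  moreover have "inj f" using assms by (simp add: semilinear_bij_def bij_is_inj)
  hence "inj_on ((`) f) (points_in UNIV)" by (auto simp: inj_on_def inj_image_eq_iff)
  ultimately have "bij_betw ((`) f) (points_in UNIV) (points_in UNIV)"
    by (simp add: bij_betw_def endo_inj_surj)
  thus ?thesis unfolding Bij_def by (auto cong: bij_betw_cong)
qed

lemma generate_fixes:
  assumes "\<sigma> \<in> Bij S" "g \<in> generate (BijGroup S) {\<sigma>}" "x \<in> S" "\<sigma> x = x"
  shows "g x = x"
  using assms(2)
proof (induction rule: generate.induct)
  case one
  thus ?case using assms(3) by (simp add: BijGroup_def)
next
  case (incl h)
  thus ?case using assms(4) by simp
next
  case (inv h)
  have "bij_betw \<sigma> S S" using assms(1) by (simp add: Bij_def)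
  hence "inv_into S \<sigma> x = x" using assms(3,4) by (metis bij_betw_def inv_into_f_f)
  thus ?case using inv assms(1,3) by (simp add: inv_BijGroup)
next
  case (eng h1 h2)
  have "h1 \<in> Bij S" "h2 \<in> Bij S"
    using group.generate_incl[OF group_BijGroup, of "{\<sigma>}" S] assms(1) eng.hyps
    by (auto simp: BijGroup_def)
  thus ?case using eng.IH assms(3) by (simp add: BijGroup_def compose_def)
qed

text \<open>The map \<open>\<pi>\<close> reading the frame coordinates \<open>i1\<close> and
  \<open>i2\<close> has kernel \<open>\<Gamma>\<close>. As \<open>l\<close> has vector dimension 2
  and meets \<open>\<Gamma>\<close> trivially, \<open>\<pi>\<close> maps it isomorphically onto the
  plane of coordinate pairs, and \<open>\<iota>\<close> is the inverse.\<close>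

lemma projection_coordinates:
  fixes T :: "'k::field ^ 'n \<Rightarrow> 'k ^ 'n" and l :: "('k ^ 'n) set"
  assumes T: "Vector_Spaces.linear (*s) (*s) T" "bij T"
    and \<Gamma>: "\<Gamma> = vec.span ((\<lambda>i. T (axis i 1)) ` (UNIV - {i1, i2}))"
    and l: "proj_subspace 1 l" "l \<inter> \<Gamma> \<subseteq> {0}"
  obtains \<iota> :: "'k ^ 2 \<Rightarrow> 'k ^ 'n" where
    "Vector_Spaces.linear (*s) (*s) \<iota>" "inj \<iota>" "range \<iota> = l"
    "\<forall>x. vec.span (\<Gamma> \<union> pt (T x)) \<inter> l = pt (\<iota> (vector [x $ i1, x $ i2]))"
proof -
  obtain T' where T': "Vector_Spaces.linear (*s) (*s) T'" "T' \<circ> T = id"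
    using vec.linear_injective_left_inverse[OF T(1) bij_is_inj[OF T(2)]] by blast
  have T'T: "T' (T x) = x" for x using T'(2) by (rule pointfree_idE)
  have TT': "T (T' v) = v" for v using bij_is_surj[OF T(2)] T'T by (metis surjD)
  define \<pi> :: "'k ^ 'n \<Rightarrow> 'k ^ 2" where "\<pi> v = vector [T' v $ i1, T' v $ i2]" for v
  have lin_\<pi>: "Vector_Spaces.linear (*s) (*s) \<pi>"
    by (rule vec_linearI)
       (simp_all add: \<pi>_def vector2_simps vec.linear_add[OF T'(1)] vec.linear_scale[OF T'(1)])
  have \<pi>T: "\<pi> (T x) = vector [x $ i1, x $ i2]" for x by (simp add: \<pi>_def T'T)
  have ker: "\<pi> v = 0 \<longleftrightarrow> v \<in> \<Gamma>" for v
  proof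
    assume "\<pi> v = 0"
    hence "\<pi> v $ 1 = 0" "\<pi> v $ 2 = 0" by simp_all
    hence z: "T' v $ i1 = 0" "T' v $ i2 = 0" by (simp_all add: \<pi>_def)
    have "v = T (\<Sum>i\<in>UNIV. T' v $ i *s axis i 1)" by (simp add: basis_expansion TT')
    also have "\<dots> = (\<Sum>i\<in>UNIV. T' v $ i *s T (axis i 1))"
      by (simp add: vec.linear_sum[OF T(1)] vec.linear_scale[OF T(1)])
    also have "\<dots> \<in> \<Gamma>" unfolding \<Gamma>
    proof (rule vec.span_sum)
      fix i
      show "T' v $ i *s T (axis i 1) \<in> vec.span ((\<lambda>i. T (axis i 1)) ` (UNIV - {i1, i2}))"
      proof (cases "i \<in> {i1, i2}")
        case True
        with z have "T' v $ i = 0" by auto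
        thus ?thesis by (simp add: vec.span_zero)
      next
        case False
        thus ?thesis by (intro vec.span_scale vec.span_base) auto
      qed
    qed
    finally show "v \<in> \<Gamma>" .
  next
    assume "v \<in> \<Gamma>"
    moreover have "\<Gamma> \<subseteq> {v. \<pi> v = 0}" unfolding \<Gamma>
    proof (rule vec.span_minimal)
      show "vec.subspace {v. \<pi> v = 0}" by (rule vec.linear_subspace_kernel[OF lin_\<pi>])
      show "(\<lambda>i. T (axis i 1)) ` (UNIV - {i1, i2}) \<subseteq> {v. \<pi> v = 0}"
        by (auto simp: \<pi>T axis_def vec_eq_iff forall_2)
    qed
    ultimately show "\<pi> v = 0" by blast
  qed
  have sub_l: "vec.subspace l" and dim_l: "vec.dim l = 2" using l(1) by (auto simp: proj_subspace_def)
  have span_l: "vec.span l = l" using sub_l by simp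
  have inj_\<pi>: "inj_on \<pi> l"
  proof (rule inj_onI)
    fix u v assume uv: "u \<in> l" "v \<in> l" "\<pi> u = \<pi> v"
    hence "\<pi> (u - v) = 0" by (simp add: vec.linear_diff[OF lin_\<pi>])
    hence "u - v \<in> \<Gamma>" using ker by blast
    moreover have "u - v \<in> l" using sub_l uv by (simp add: vec.subspace_diff)
    ultimately have "u - v = 0" using l(2) by blast
    thus "u = v" by simp
  qed
  have "\<pi> ` l = UNIV"
  proof (rule vec.subspace_dim_equal)
    show "vec.subspace (\<pi> ` l)" using vec.linear_subspace_image[OF lin_\<pi> sub_l] .
    have "vec.dim (\<pi> ` l) = vec.dim l"
      by (rule vec.dim_image_eq[OF lin_\<pi>]) (simp add: span_l inj_\<pi>)
    thus "vec.dim (UNIV :: ('k ^ 2) set) \<le> vec.dim (\<pi> ` l)"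
      using vec_dim_card[where 'a = 'k and 'n = 2] by (simp add: dim_l del: vec.dim_UNIV)
  qed auto
  obtain \<iota> where \<iota>: "range \<iota> \<subseteq> l" "Vector_Spaces.linear (*s) (*s) \<iota>" "\<And>v. v \<in> l \<Longrightarrow> \<iota> (\<pi> v) = v"
    using vec.linear_inj_on_left_inverse[OF lin_\<pi>, of l] inj_\<pi> span_l by auto
  have \<pi>\<iota>: "\<pi> (\<iota> w) = w" for w using \<open>\<pi> ` l = UNIV\<close> \<iota>(3) by (metis UNIV_I imageE)
  have "inj \<iota>" using \<pi>\<iota> by (metis injI)
  moreover have "range \<iota> = l" using \<iota>(1,3) by (metis rangeI subsetI subset_antisym)
  moreover have "vec.span (\<Gamma> \<union> pt (T x)) \<inter> l = pt (\<iota> (vector [x $ i1, x $ i2]))" for x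
  proof -
    \<comment> \<open>The unique vector of \<open>l\<close> congruent to \<open>T x\<close> modulo
      \<open>\<Gamma>\<close>.\<close>
    define u where "u = \<iota> (\<pi> (T x))"
    have u: "u \<in> l" "\<pi> u = \<pi> (T x)" using \<iota>(1) \<pi>\<iota> by (auto simp: u_def)
    hence "\<pi> (u - T x) = 0" by (simp add: vec.linear_diff[OF lin_\<pi>])
    hence uT: "u - T x \<in> \<Gamma>" using ker by blast
    have "vec.span (\<Gamma> \<union> pt (T x)) \<inter> l = pt u"
    proof (rule subset_antisym; rule subsetI)
      fix z assume z: "z \<in> vec.span (\<Gamma> \<union> pt (T x)) \<inter> l"
      then obtain g w where gw: "z = g + w" "g \<in> vec.span \<Gamma>" "w \<in> vec.span (pt (T x))"
        by (auto simp: vec.span_Un)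
      have "g \<in> \<Gamma>" using gw(2) unfolding \<Gamma> vec.span_span .
      moreover obtain c where "w = c *s T x" using gw(3) unfolding vec.span_span by (auto simp: vec.span_singleton)
      ultimately have "\<pi> z = c *s \<pi> (T x)"
        using ker gw(1) by (simp add: vec.linear_add[OF lin_\<pi>] vec.linear_scale[OF lin_\<pi>])
      hence "z = \<iota> (c *s \<pi> (T x))" using \<iota>(3)[of z] z by simp
      hence "z = c *s u" by (simp add: u_def vec.linear_scale[OF \<iota>(2)])
      thus "z \<in> pt u" by (auto simp: vec.span_singleton)
    next
      fix z assume "z \<in> pt u"
      then obtain c where z: "z = c *s u" by (auto simp: vec.span_singleton)
      have "u = (u - T x) + T x" by simp
      moreover have "u - T x \<in> vec.span (\<Gamma> \<union> pt (T x))" using uT by (simp add: vec.span_base)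
      moreover have "T x \<in> vec.span (\<Gamma> \<union> pt (T x))" by (simp add: vec.span_base)
      ultimately have "u \<in> vec.span (\<Gamma> \<union> pt (T x))" by (metis vec.span_add)
      thus "z \<in> vec.span (\<Gamma> \<union> pt (T x)) \<inter> l"
        using u(1) sub_l by (simp add: z vec.span_scale vec.subspace_scale)
    qed
    thus ?thesis by (simp add: u_def \<pi>T)
  qed
  ultimately show ?thesis using that \<iota>(2) by blast
qed

section \<open>Frames over the subfield and collineations fixing a subgeometry pointwise\<close>

lemma linear_combination_bij:
  fixes b :: "nat \<Rightarrow> 'k::field ^ 'n"
  assumes "vec.span (b ` {..<CARD('n)}) = UNIV"
  defines "B \<equiv> \<lambda>x :: 'k ^ 'n. \<Sum>i\<in>UNIV. x $ i *s b (idx i)"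
  shows "Vector_Spaces.linear (*s) (*s) B" "bij B" "B (axis i 1) = b (idx i)"
proof -
  show lin: "Vector_Spaces.linear (*s) (*s) B"
    by (rule vec_linearI)
       (simp_all add: B_def vec.scale_left_distrib sum.distrib vec.scale_sum_right)
  show ax: "B (axis i 1) = b (idx i)" for i
  proof -
    have "B (axis i 1) = (\<Sum>j\<in>UNIV. if j = i then b (idx j) else 0)"
      unfolding B_def by (rule sum.cong) (auto simp: axis_def)
    thus ?thesis by simp
  qed
  have "b ` {..<CARD('n)} \<subseteq> range B"
  proof
    fix v assume "v \<in> b ` {..<CARD('n)}"
    then obtain j where j: "v = b j" "j < CARD('n)" by auto
    then obtain i :: 'n where "idx i = j" using ex_idx by blast
    thus "v \<in> range B" using ax[of i] j by (metis rangeI)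
  qed
  moreover have "vec.subspace (range B)"
    using vec.linear_subspace_image[OF lin vec.subspace_UNIV] .
  ultimately have "vec.span (b ` {..<CARD('n)}) \<subseteq> range B" by (rule vec.span_minimal)
  hence "surj B" using assms(1) by blast
  thus "bij B" using vec.linear_surj_imp_inj[OF lin] by (simp add: bij_def)
qed

text \<open>Since the points of \<open>X\<close> span the space, so do the \<open>CARD('n)\<close>
  basis vectors of \<open>W\<close>, which therefore form a basis over the large field; in it
  \<open>W\<close> is given by coordinates in \<open>Fq q\<close>.\<close>

lemma canonical_subgeometry_frame:
  fixes X :: "('k::field ^ 'n) set set"
  assumes "canonical_subgeometry q X"
  obtains B :: "'k ^ 'n \<Rightarrow> 'k ^ 'n" where "Vector_Spaces.linear (*s) (*s) B" "bij B"
    "X = {pt (B x) | x. x \<noteq> 0 \<and> (\<forall>i. x $ i \<in> Fq q)}"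
proof -
  let ?N = "CARD('n)"
  obtain W where W: "Fq_subspace q ?N W" "X = {pt w | w. w \<in> W - {0}}" "vec.span (\<Union>X) = UNIV"
    using assms unfolding canonical_subgeometry_def by blast
  obtain b where b: "W = {\<Sum>i<?N. c i *s b i | c. \<forall>i<?N. c i \<in> Fq q}"
    using W(1) unfolding Fq_subspace_def by blast
  define B where "B x = (\<Sum>i\<in>UNIV. x $ i *s b (idx i))" for x :: "'k ^ 'n"
  have "(\<Sum>i<?N. c i *s b i) \<in> vec.span (b ` {..<?N})" for c
    by (intro vec.span_sum vec.span_scale vec.span_base) auto
  hence "W \<subseteq> vec.span (b ` {..<?N})" unfolding b by blast
  hence "\<Union>X \<subseteq> vec.span (b ` {..<?N})" unfolding W(2)
    by (auto simp: vec.span_singleton intro!: vec.span_scale)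
  hence "vec.span (b ` {..<?N}) = UNIV" using W(3) by (metis top.extremum_uniqueI vec.span_minimal vec.subspace_span)
  hence B: "Vector_Spaces.linear (*s) (*s) B" "bij B"
    unfolding B_def[abs_def] by (rule linear_combination_bij)+
  have "W = {B x | x. \<forall>i. x $ i \<in> Fq q}"
  proof (rule subset_antisym; rule subsetI)
    fix w assume "w \<in> W"
    then obtain c where c: "w = (\<Sum>i<?N. c i *s b i)" "\<forall>i<?N. c i \<in> Fq q" unfolding b by blast
    have "w = B (\<chi> i. c (idx i))" unfolding c(1) B_def
      using sum_idx[where ?'n = 'n, of "\<lambda>j. c j *s b j"] by simp
    moreover have "\<forall>i. (\<chi> i :: 'n. c (idx i)) $ i \<in> Fq q" using c(2) idx_less[where ?'n = 'n] by simp
    ultimately show "w \<in> {B x | x. \<forall>i. x $ i \<in> Fq q}" by blast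
  next
    fix w assume "w \<in> {B x | x. \<forall>i. x $ i \<in> Fq q}"
    then obtain x where x: "w = B x" "\<forall>i. x $ i \<in> Fq q" by blast
    define c where "c j = x $ (inv_into UNIV idx j)" for j
    have "x $ i = c (idx i)" for i
      using bij_betw_imp_inj_on[OF bij_idx[where ?'n = 'n]] by (simp add: c_def)
    hence "w = (\<Sum>i<?N. c i *s b i)" unfolding x(1) B_def
      using sum_idx[where ?'n = 'n, of "\<lambda>j. c j *s b j"] by simp
    moreover have "\<forall>i<?N. c i \<in> Fq q" using x(2) by (simp add: c_def)
    ultimately show "w \<in> W" unfolding b by blast
  qed
  moreover have "B x = 0 \<longleftrightarrow> x = 0" for x
    by (rule linear_bij_eq_0_iff[OF B])
  ultimately have "X = {pt (B x) | x. x \<noteq> 0 \<and> (\<forall>i. x $ i \<in> Fq q)}" unfolding W(2) by blast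
  with B show ?thesis by (rule that)
qed

text \<open>Applied to Frobenius it supplies a member of the pointwise stabilizer of the
  subgeometry.\<close>

lemma frame_semilinear:
  fixes B :: "'k::field ^ 'n \<Rightarrow> 'k ^ 'n"
  assumes B: "Vector_Spaces.linear (*s) (*s) B" "bij B" and \<alpha>: "field_automorphism \<alpha>"
  obtains h where "semilinear_bij h" "\<And>x. h (B x) = B (\<chi> i. \<alpha> (x $ i))"
proof -
  obtain B' where B': "Vector_Spaces.linear (*s) (*s) B'" "B' \<circ> B = id"
    using vec.linear_injective_left_inverse[OF B(1) bij_is_inj[OF B(2)]] by blast
  have B'B: "B' (B x) = x" for x using B'(2) by (rule pointfree_idE)
  have BB': "B (B' v) = v" for v using bij_is_surj[OF B(2)] B'B by (metis surjD)
  have add: "\<alpha> (x + y) = \<alpha> x + \<alpha> y" and mult: "\<alpha> (x * y) = \<alpha> x * \<alpha> y" and bij: "bij \<alpha>" for x y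
    using \<alpha> by (auto simp: field_automorphism_def)
  define h where "h v = B (\<chi> i. \<alpha> (B' v $ i))" for v
  have "semilinear_bij h" unfolding semilinear_bij_def
  proof (intro conjI allI exI[of _ \<alpha>] \<alpha>)
    show "h (u + v) = h u + h v" for u v
    proof -
      have "(\<chi> i. \<alpha> (B' (u + v) $ i)) = (\<chi> i. \<alpha> (B' u $ i)) + (\<chi> i. \<alpha> (B' v $ i))"
        by (simp add: vec_eq_iff vec.linear_add[OF B'(1)] add)
      thus ?thesis by (simp add: h_def vec.linear_add[OF B(1)])
    qed
    show "h (c *s v) = \<alpha> c *s h v" for c v
    proof -
      have "(\<chi> i. \<alpha> (B' (c *s v) $ i)) = \<alpha> c *s (\<chi> i. \<alpha> (B' v $ i))"
        by (simp add: vec_eq_iff vec.linear_scale[OF B'(1)] mult)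
      thus ?thesis by (simp add: h_def vec.linear_scale[OF B(1)])
    qed
    show "bij h"
    proof (rule o_bij)
      show "(\<lambda>v. B (\<chi> i. inv_into UNIV \<alpha> (B' v $ i))) \<circ> h = id"
        using bij by (auto simp: h_def B'B BB' bij_is_inj)
      show "h \<circ> (\<lambda>v. B (\<chi> i. inv_into UNIV \<alpha> (B' v $ i))) = id"
        using bij by (auto simp: h_def B'B BB' bij_is_surj surj_f_inv_f)
    qed
  qed
  moreover have "h (B x) = B (\<chi> i. \<alpha> (x $ i))" for x by (simp add: h_def B'B)
  ultimately show ?thesis by (rule that)
qed

lemma field_automorphism_frobenius:
  assumes "CARD('k::{field,finite}) = q ^ t" "t > 0"
  shows "field_automorphism (\<lambda>x :: 'k. x ^ q)"
proof -
  have "q > 0" using assms finite_UNIV_card_ge_0[where 'a='k] by (cases "q = 0") (auto simp: power_0_left)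
  have "inj (\<lambda>x :: 'k. x ^ q)"
  proof (rule injI)
    fix x y :: 'k assume "x ^ q = y ^ q"
    hence "(x - y) ^ q = 0" using frobenius_add[OF assms, of "x - y" y] by simp
    thus "x = y" by simp
  qed
  hence "bij (\<lambda>x :: 'k. x ^ q)" by (simp add: bij_def finite_UNIV_inj_surj)
  thus ?thesis by (simp add: field_automorphism_def frobenius_add[OF assms] power_mult_distrib)
qed

text \<open>The frame points are fixed, so each frame vector is scaled by some \<open>d i\<close>.
  Fixing also the points with coordinates 1 at \<open>i\<close> and \<open>x\<close> at
  \<open>j\<close>, for \<open>x\<close> in \<open>Fq q\<close>, forces
  \<open>d j * \<alpha> x = d i * x\<close>. With \<open>x = 1\<close> all scalars agree, and then
  \<open>\<alpha>\<close> fixes \<open>Fq q\<close>.\<close>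

lemma pointwise_stabilizer_frame:
  fixes B :: "'k::field ^ 'n \<Rightarrow> 'k ^ 'n"
  assumes B: "Vector_Spaces.linear (*s) (*s) B" "bij B" and n2: "CARD('n) \<ge> 2" and q: "q > 0"
    and \<sigma>: "\<sigma> \<in> pointwise_stabilizer {pt (B x) | x. x \<noteq> 0 \<and> (\<forall>i. x $ i \<in> Fq q)}"
  obtains f0 \<alpha> c where "semilinear_bij f0" "\<sigma> = restrict ((`) f0) (points_in UNIV)"
    "field_automorphism \<alpha>" "\<forall>x\<in>Fq q. \<alpha> x = x" "c \<noteq> 0"
    "\<forall>x. f0 (B x) = c *s B (\<chi> i. \<alpha> (x $ i))"
proof -
  obtain f0 where f0: "semilinear_bij f0" "\<sigma> = restrict ((`) f0) (points_in UNIV)"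
    using \<sigma> unfolding pointwise_stabilizer_def PGammaL_def by blast
  obtain \<alpha> where \<alpha>: "field_automorphism \<alpha>" and scale: "\<And>c v. f0 (c *s v) = \<alpha> c *s f0 v"
    using f0(1) unfolding semilinear_bij_def by blast
  have add: "f0 (u + v) = f0 u + f0 v" for u v using f0(1) unfolding semilinear_bij_def by blast
  have F: "0 \<in> (Fq q :: 'k set)" "1 \<in> (Fq q :: 'k set)" using q by (auto simp: Fq_def)
  have B0: "B x = 0 \<longleftrightarrow> x = 0" for x
    by (rule linear_bij_eq_0_iff[OF B])
  have fixes_pt: "\<exists>d. f0 (B x) = B (d *s x)" if "x \<noteq> 0" "\<forall>i. x $ i \<in> Fq q" for x
  proof -
    have "\<sigma> (pt (B x)) = pt (B x)" using \<sigma> that unfolding pointwise_stabilizer_def by blast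
    moreover have "pt (B x) \<in> points_in UNIV" using that B0 by (auto simp: points_in_UNIV_iff)
    ultimately have "pt (f0 (B x)) = pt (B x)" by (simp add: f0(2) semilinear_image_pt[OF f0(1)])
    then obtain d where "f0 (B x) = d *s B x" by (auto dest: pt_eqD)
    thus ?thesis by (auto simp: vec.linear_scale[OF B(1)])
  qed
  have "\<exists>d. f0 (B (axis i 1)) = B (d *s axis i 1)" for i
    using F by (intro fixes_pt) (auto simp: axis_def vec_eq_iff)
  then obtain d where d: "\<And>i. f0 (B (axis i 1)) = B (d i *s axis i 1)" by metis
  have pair: "d j * \<alpha> x = d i * x" if "i \<noteq> j" "x \<in> Fq q" for i j x
  proof -
    have "axis i 1 + x *s axis j 1 \<noteq> 0"
    proof
      assume "axis i 1 + x *s axis j 1 = 0"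
      hence "(axis i 1 + x *s axis j 1) $ i = 0" by simp
      thus False using that(1) by (simp add: axis_def)
    qed
    moreover have "\<forall>k. (axis i 1 + x *s axis j 1) $ k \<in> Fq q"
      using F that by (auto simp: axis_def)
    ultimately obtain e where
        "f0 (B (axis i 1 + x *s axis j 1)) = B (e *s (axis i 1 + x *s axis j 1))"
      using fixes_pt by blast
    moreover have "f0 (B (axis i 1 + x *s axis j 1)) = B (d i *s axis i 1 + (\<alpha> x * d j) *s axis j 1)"
      by (simp add: vec.linear_add[OF B(1)] vec.linear_scale[OF B(1)] add scale d)
    ultimately have "e *s (axis i 1 + x *s axis j 1) = d i *s axis i 1 + (\<alpha> x * d j) *s axis j 1"
      using bij_is_inj[OF B(2)] by (simp add: inj_eq)
    hence "(e *s (axis i 1 + x *s axis j 1)) $ k = (d i *s axis i 1 + (\<alpha> x * d j) *s axis j 1) $ k" for k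
      by simp
    from this[of i] this[of j] have "e = d i" "e * x = \<alpha> x * d j"
      using that(1) by (simp_all add: axis_def)
    thus ?thesis by (simp add: mult.commute)
  qed
  have \<alpha>1: "\<alpha> 1 = 1" using \<alpha> by (simp add: field_automorphism_def)
  have d_eq: "d j = d i" for i j using pair[of i j 1] F \<alpha>1 by (cases "i = j") auto
  define c where "c = d undefined"
  have dc: "d i = c" for i using d_eq[of i undefined] by (simp add: c_def)
  have c: "c \<noteq> 0"
  proof
    assume "c = 0"
    hence "f0 (B (axis undefined 1)) = 0" by (simp add: d dc vec.linear_0[OF B(1)])
    hence "axis undefined (1 :: 'k) = (0 :: 'k ^ 'n)" using semilinear_eq_0[OF f0(1)] B0 by blast
    thus False by (metis axis_nth zero_index zero_neq_one)
  qed
  have fixed: "\<forall>x\<in>Fq q. \<alpha> x = x"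
  proof
    fix x :: 'k assume x: "x \<in> Fq q"
    obtain i j :: 'n where "i \<noteq> j"
      using ex_other_index[OF n2] by blast
    thus "\<alpha> x = x" using pair[OF _ x] c dc by auto
  qed
  have sum: "f0 (sum g A) = (\<Sum>i\<in>A. f0 (g i))" if "finite A" for g and A :: "'n set"
    using that by induction (auto simp: add semilinear_eq_0[OF f0(1)])
  have "f0 (B x) = c *s B (\<chi> i. \<alpha> (x $ i))" for x
  proof -
    have exp: "B y = (\<Sum>i\<in>UNIV. y $ i *s B (axis i 1))" for y
      by (subst basis_expansion[symmetric]) (simp add: vec.linear_sum[OF B(1)] vec.linear_scale[OF B(1)])
    have "f0 (B x) = (\<Sum>i\<in>UNIV. \<alpha> (x $ i) *s f0 (B (axis i 1)))"
      by (subst exp) (simp add: sum scale)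
    also have "\<dots> = c *s (\<Sum>i\<in>UNIV. \<alpha> (x $ i) *s B (axis i 1))"
      by (simp add: d dc vec.linear_scale[OF B(1)] vec.scale_sum_right mult.commute)
    also have "(\<Sum>i\<in>UNIV. \<alpha> (x $ i) *s B (axis i 1)) = B (\<chi> i. \<alpha> (x $ i))"
      by (subst (2) exp) simp
    finally show ?thesis .
  qed
  thus ?thesis using that[OF f0 \<alpha> fixed c] by blast
qed

text \<open>Every element of the group generated by \<open>\<sigma>\<close> fixes the points fixed by \<open>\<sigma>\<close>. One element
  is the collineation with Frobenius automorphism, and \<open>\<sigma>\<close> fixes \<open>\<langle>b\<^sub>i + x b\<^sub>j\<rangle>\<close> if \<open>\<alpha> x = x\<close>.\<close>

lemma fixed_field_stabilizer_generator:
  fixes B :: "'k::{field,finite} ^ 'n \<Rightarrow> 'k ^ 'n"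
  assumes card: "CARD('k) = q ^ t" "t > 0" and n2: "CARD('n) \<ge> 2"
    and B: "Vector_Spaces.linear (*s) (*s) B" "bij B"
    and X: "X = {pt (B x) | x. x \<noteq> 0 \<and> (\<forall>i. x $ i \<in> Fq q)}"
    and gen: "stabilizer_generator X \<sigma>"
    and f0: "semilinear_bij f0" "\<sigma> = restrict ((`) f0) (points_in UNIV)"
    and \<alpha>: "field_automorphism \<alpha>" "c \<noteq> 0" "\<And>x. f0 (B x) = c *s B (\<chi> i. \<alpha> (x $ i))"
    and x: "\<alpha> x = x"
  shows "x \<in> Fq q"
proof -
  have \<alpha>01: "\<alpha> 1 = 1" "\<alpha> 0 = 0"
    using \<alpha>(1) unfolding field_automorphism_def by (auto, metis add_cancel_left_right)
  have B0: "B y = 0 \<longleftrightarrow> y = 0" for y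
    by (rule linear_bij_eq_0_iff[OF B])
  obtain i j :: 'n where ij: "i \<noteq> j"
    using ex_other_index[OF n2] by blast
  define v where "v = (\<chi> k. if k = i then 1 else if k = j then x else 0)"
  have "v $ i = 1" by (simp add: v_def)
  hence "v \<noteq> 0" by auto
  hence P: "pt (B v) \<in> points_in UNIV" using B0 by (auto simp: points_in_UNIV_iff)
  have "(\<chi> k. \<alpha> (v $ k)) = v" by (simp add: v_def vec_eq_iff \<alpha>01 x)
  hence "f0 (B v) = c *s B v" by (simp add: \<alpha>(3))
  hence fixed: "\<sigma> (pt (B v)) = pt (B v)"
    using P \<alpha>(2) by (simp add: f0(2) semilinear_image_pt[OF f0(1)] pt_scale)
  obtain h where h: "semilinear_bij h" "\<And>y. h (B y) = B (\<chi> i. (y $ i) ^ q)"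
    using frame_semilinear[OF B field_automorphism_frobenius[OF card]] by blast
  define g where "g = restrict ((`) h) (points_in UNIV)"
  have "g \<in> pointwise_stabilizer X"
    unfolding pointwise_stabilizer_def PGammaL_def
  proof (intro CollectI conjI ballI)
    show "\<exists>f. g = restrict ((`) f) (points_in UNIV) \<and> semilinear_bij f" using h(1) g_def by blast
    fix Y assume "Y \<in> X"
    then obtain y where y: "Y = pt (B y)" "y \<noteq> 0" "\<forall>i. y $ i \<in> Fq q" unfolding X by blast
    have "(\<chi> i. (y $ i) ^ q) = y" using y(3) by (simp add: vec_eq_iff Fq_def)
    hence "h (B y) = B y" by (simp add: h(2))
    moreover have "pt (B y) \<in> points_in UNIV" using y(2) B0 by (auto simp: points_in_UNIV_iff)
    ultimately show "g Y = Y" by (simp add: g_def y(1) semilinear_image_pt[OF h(1)])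
  qed
  hence "g \<in> generate (BijGroup (points_in UNIV)) {\<sigma>}"
    using gen by (simp add: stabilizer_generator_def)
  moreover have "\<sigma> \<in> Bij (points_in UNIV)" unfolding f0(2) by (rule collineation_in_Bij[OF f0(1)])
  ultimately have "g (pt (B v)) = pt (B v)" using P fixed by (metis generate_fixes)
  hence "pt (h (B v)) = pt (B v)" using P by (simp add: g_def semilinear_image_pt[OF h(1)])
  then obtain e where "B (\<chi> k. (v $ k) ^ q) = e *s B v" by (auto dest: pt_eqD simp: h(2))
  hence "(\<chi> k. (v $ k) ^ q) = e *s v"
    using bij_is_inj[OF B(2)] by (simp add: inj_eq flip: vec.linear_scale[OF B(1)])
  hence "(v $ k) ^ q = e * v $ k" for k by (simp add: vec_eq_iff)
  \<comment> \<open>Coordinate \<open>i\<close> of \<open>v\<close> is 1, which gives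
    \<open>e = 1\<close>; coordinate \<open>j\<close> then reads \<open>x ^ q = x\<close>.\<close>
  from this[of i] this[of j] show ?thesis using ij by (simp add: v_def Fq_def)
qed

section \<open>Cyclic coordinates on the subgeometry\<close>

lemma span_Union_pt: "vec.span (\<Union>i\<in>I. pt (u i)) = vec.span (u ` I)"
  for u :: "'i \<Rightarrow> 'k::field ^ 'n"
proof (rule subset_antisym)
  have "pt (u i) \<subseteq> vec.span (u ` I)" if "i \<in> I" for i
    using that by (intro vec.span_mono) auto
  thus "vec.span (\<Union>i\<in>I. pt (u i)) \<subseteq> vec.span (u ` I)" by (intro vec.span_minimal) auto
  have "u i \<in> (\<Union>i\<in>I. pt (u i))" if "i \<in> I" for i using that vec.span_base[of "u i" "{u i}"] by blast
  thus "vec.span (u ` I) \<subseteq> vec.span (\<Union>i\<in>I. pt (u i))" by (intro vec.span_mono) auto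
qed

lemma card_Fq_vectors:
  assumes "CARD('k::{field,finite}) = q ^ t" "t > 0" "CARD('n) = t"
  shows "card {x :: 'k ^ 'n. \<forall>i. x $ i \<in> Fq q} \<le> q ^ t"
proof -
  let ?F = "PiE UNIV (\<lambda>_ :: 'n. Fq q :: 'k set)"
  have "{x :: 'k ^ 'n. \<forall>i. x $ i \<in> Fq q} \<subseteq> vec_lambda ` ?F"
  proof
    fix x :: "'k ^ 'n" assume "x \<in> {x. \<forall>i. x $ i \<in> Fq q}"
    hence "vec_nth x \<in> ?F" by auto
    thus "x \<in> vec_lambda ` ?F" by (metis imageI vec_nth_inverse)
  qed
  hence "card {x :: 'k ^ 'n. \<forall>i. x $ i \<in> Fq q} \<le> card ?F"
    by (rule surj_card_le[rotated]) (auto intro: finite_PiE)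
  also have "\<dots> = q ^ t" by (simp add: card_PiE card_Fq[OF assms(1,2)] assms(3))
  finally show ?thesis .
qed

text \<open>The vectors on the right are fixed by \<open>f\<close>, hence lie in the subgeometry, and there are
  \<open>q ^ t\<close> of them, as many as on the left.\<close>

lemma subgeometry_in_cyclic_frame:
  fixes B T f :: "'k::{field,finite} ^ 'n \<Rightarrow> 'k ^ 'n"
  assumes aut: "field_aut \<alpha> q t" and card_n: "CARD('n) = t"
    and B: "Vector_Spaces.linear (*s) (*s) B" "bij B"
    and f: "\<And>x. f (B x) = B (\<chi> i. \<alpha> (x $ i))"
    and T: "Vector_Spaces.linear (*s) (*s) T" "bij T" "\<And>i. T (axis i 1) = (f ^^ idx i) v"
  shows "{B x | x. x \<noteq> 0 \<and> (\<forall>i. x $ i \<in> Fq q)} = {T (\<chi> i. (\<alpha> ^^ idx i) a) | a. a \<noteq> 0}"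
proof -
  interpret field_aut \<alpha> q t by fact
  define \<omega> :: "'k \<Rightarrow> 'k ^ 'n" where "\<omega> a = (\<chi> i. (\<alpha> ^^ idx i) a)" for a
  have B_surj: "\<exists>x. v = B x" for v using bij_is_surj[OF B(2)] by (metis surjD)
  have f_add: "f (u + v) = f u + f v" for u v
  proof -
    obtain x y where "u = B x" "v = B y" using B_surj by metis
    moreover have "(\<chi> i. \<alpha> ((x + y) $ i)) = (\<chi> i. \<alpha> (x $ i)) + (\<chi> i. \<alpha> (y $ i))"
      by (simp add: vec_eq_iff)
    ultimately show ?thesis by (simp add: f flip: vec.linear_add[OF B(1)])
  qed
  have f_scale: "f (k *s v) = \<alpha> k *s f v" for k v
  proof -
    obtain x where "v = B x" using B_surj by metis
    moreover have "(\<chi> i. \<alpha> ((k *s x) $ i)) = \<alpha> k *s (\<chi> i. \<alpha> (x $ i))" by (simp add: vec_eq_iff)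
    ultimately show ?thesis by (simp add: f flip: vec.linear_scale[OF B(1)])
  qed
  have f_sum: "f (sum g A) = (\<Sum>i\<in>A. f (g i))" if "finite A" for g and A :: "nat set"
    using that
  proof induction
    case empty
    show ?case using f_scale[of 0 0] by simp
  qed (simp add: f_add)
  have f_pow: "(f ^^ n) (B x) = B (\<chi> i. (\<alpha> ^^ n) (x $ i))" for n x
    by (induction n) (simp_all add: f)
  have ft: "(f ^^ t) v = v"
  proof -
    obtain x where "v = B x" using B_surj by metis
    thus ?thesis by (simp add: f_pow period)
  qed
  have T_expand: "T x = (\<Sum>i\<in>UNIV. x $ i *s (f ^^ idx i) v)" for x
    by (subst basis_expansion[symmetric])
       (simp add: vec.linear_sum[OF T(1)] vec.linear_scale[OF T(1)] T(3))
  have T\<omega>: "T (\<omega> a) = (\<Sum>j<t. (\<alpha> ^^ j) a *s (f ^^ j) v)" for a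
    using sum_idx[where ?'n = 'n, of "\<lambda>j. (\<alpha> ^^ j) a *s (f ^^ j) v"]
    by (simp add: T_expand \<omega>_def card_n)
  have f\<omega>: "f (T (\<omega> a)) = T (\<omega> a)" for a
  proof -
    \<comment> \<open>\<open>f\<close> sends each summand to the next; the last returns to the first
      because \<open>t\<close> is a period of both \<open>\<alpha>\<close> at \<open>a\<close> and
      \<open>f\<close> at \<open>v\<close>.\<close>
    let ?g = "\<lambda>j. (\<alpha> ^^ j) a *s (f ^^ j) v"
    have "f (T (\<omega> a)) = (\<Sum>j<t. ?g (Suc j))" by (simp add: T\<omega> f_sum f_scale)
    also have "\<dots> = (\<Sum>j<t. ?g j)"
      using sum.lessThan_Suc_shift[of ?g t] sum.lessThan_Suc[of ?g t] by (simp add: ft period)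
    finally show ?thesis by (simp add: T\<omega>)
  qed
  have "range (\<lambda>a. T (\<omega> a)) \<subseteq> B ` {x. \<forall>i. x $ i \<in> Fq q}"
  proof
    fix w assume "w \<in> range (\<lambda>a. T (\<omega> a))"
    hence "f w = w" using f\<omega> by auto
    moreover obtain x where x: "w = B x" using B_surj by metis
    ultimately have "(\<chi> i. \<alpha> (x $ i)) = x" using bij_is_inj[OF B(2)] by (simp add: f inj_eq)
    hence "\<forall>i. x $ i \<in> Fq q" by (simp add: vec_eq_iff fixed_iff)
    thus "w \<in> B ` {x. \<forall>i. x $ i \<in> Fq q}" using x by blast
  qed
  moreover have inj\<omega>: "inj \<omega>"
  proof (rule injI)
    fix a b assume "\<omega> a = \<omega> b"
    hence "(\<alpha> ^^ idx (undefined :: 'n)) a = (\<alpha> ^^ idx (undefined :: 'n)) b"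
      by (simp add: \<omega>_def vec_eq_iff)
    thus "a = b" by (simp add: funpow_eq_iff)
  qed
  have injT\<omega>: "inj (\<lambda>a. T (\<omega> a))"
    using inj_compose[OF bij_is_inj[OF T(2)] inj\<omega>] by (simp add: comp_def)
  have "card (B ` {x. \<forall>i. x $ i \<in> Fq q}) \<le> card (range (\<lambda>a. T (\<omega> a)))"
  proof -
    have "card (B ` {x. \<forall>i. x $ i \<in> Fq q}) \<le> card {x :: 'k ^ 'n. \<forall>i. x $ i \<in> Fq q}"
      by (rule card_image_le) simp
    also have "\<dots> \<le> q ^ t" using card_Fq_vectors[OF card_k _ card_n] t_ge by simp
    also have "\<dots> = card (range (\<lambda>a. T (\<omega> a)))" using injT\<omega> by (simp add: card_image card_k)
    finally show ?thesis .
  qed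
  ultimately have eq: "range (\<lambda>a. T (\<omega> a)) = B ` {x. \<forall>i. x $ i \<in> Fq q}"
    by (intro card_seteq) auto
  have B0: "B x = 0 \<longleftrightarrow> x = 0" for x
    by (rule linear_bij_eq_0_iff[OF B])
  have "\<omega> 0 = 0" by (simp add: \<omega>_def vec_eq_iff)
  hence T0: "T (\<omega> 0) = 0" by (simp add: vec.linear_0[OF T(1)])
  have T\<omega>0: "T (\<omega> a) = 0 \<longleftrightarrow> a = 0" for a
    using injD[OF injT\<omega>, of a 0] T0 by auto
  have "{B x | x. x \<noteq> 0 \<and> (\<forall>i. x $ i \<in> Fq q)} = B ` {x. \<forall>i. x $ i \<in> Fq q} - {0}"
    by (auto simp: B0)
  also have "\<dots> = {T (\<omega> a) | a. a \<noteq> 0}" unfolding eq[symmetric] by (auto simp: T\<omega>0)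
  finally show ?thesis by (simp only: \<omega>_def)
qed

section \<open>The value of the count and the assembly of the theorem\<close>

lemma theta_identity:
  assumes "q > 1" "t \<ge> 3" "N * ((q\<^sup>2 - 1) * (q\<^sup>2 - q)) = (q ^ t - 1) * (q ^ t - q)"
  shows "real N = theta q (t - 1) * theta q (t - 2) / theta q 1"
proof -
  define s where "s = t - 2"
  have s: "t = Suc (Suc s)" using assms(2) by (simp add: s_def)
  \<comment> \<open>These bounds ensure that no subtraction of naturals is truncated when passing to
    the reals.\<close>
  have "q \<le> q ^ 2" "q \<le> q ^ t" "1 \<le> q ^ 2" "1 \<le> q ^ t"
    using assms(1,2) self_le_power[of q] by auto
  moreover have "real (N * ((q\<^sup>2 - 1) * (q\<^sup>2 - q))) = real ((q ^ t - 1) * (q ^ t - q))"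
    using assms(3) by simp
  ultimately have eq: "real N * ((real q ^ 2 - 1) * (real q ^ 2 - real q)) =
      (real q ^ t - 1) * (real q ^ t - real q)"
    by (simp add: of_nat_diff)
  have q: "real q > 1" using assms(1) by simp
  have nz: "real q - 1 \<noteq> 0" "real q \<noteq> 0" "real q ^ 2 - 1 \<noteq> 0"
    using q by (auto simp: power2_eq_1_iff)
  \<comment> \<open>Both \<open>q\<^sup>2 - q\<close> and \<open>q ^ t - q\<close> contain a factor
    \<open>q\<close>, which is cancelled.\<close>
  have "real q * (real N * ((real q ^ 2 - 1) * (real q - 1))) =
      real q * ((real q ^ t - 1) * (real q ^ (t - 1) - 1))"
    using eq by (simp add: s power2_eq_square algebra_simps)
  hence "real N * ((real q ^ 2 - 1) * (real q - 1)) = (real q ^ t - 1) * (real q ^ (t - 1) - 1)"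
    using nz(2) by simp
  hence "real N = (real q ^ t - 1) * (real q ^ (t - 1) - 1) / ((real q ^ 2 - 1) * (real q - 1))"
    using nz by (simp add: eq_divide_eq)
  also have "\<dots> = theta q (t - 1) * theta q (t - 2) / theta q 1"
  proof -
    have "x * y / (z * d) = (x / d) * (y / d) / (z / d)" if "d \<noteq> 0" for x y z d :: real
      using that by (simp add: field_simps)
    note this[OF nz(1)]
    moreover have "t - 1 + 1 = t" "t - 2 + 1 = t - 1" "1 + 1 = (2 :: nat)" using assms(2) by simp_all
    ultimately show ?thesis unfolding theta_def by (simp only:)
  qed
  finally show ?thesis .
qed

theorem theorem4p12:
  fixes q t :: nat
    and Sub :: "('k::{field,finite} ^ 'n) set set"
    and \<Gamma> l\<^sub>0 P :: "('k ^ 'n) set"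
    and L :: "('k ^ 'n) set set"
    and \<sigma> :: "('k ^ 'n) set \<Rightarrow> ('k ^ 'n) set"
  assumes "prime t" and "t \<ge> 3" and "q \<ge> t + 1"
    and "CARD('k) = q ^ t" and "CARD('n) = t"
    and "canonical_subgeometry q Sub"
    and "proj_subspace (t - 3) \<Gamma>" and "proj_subspace 1 l\<^sub>0"
    and "Sub \<inter> points_in \<Gamma> = {}" and "points_in l\<^sub>0 \<inter> points_in \<Gamma> = {}"
    and "L = projection \<Gamma> l\<^sub>0 Sub"
    and "scattered_linear_set q l\<^sub>0 L" and "pseudoregulus_type q l\<^sub>0 L"
    and "stabilizer_generator Sub \<sigma>"
    and "P \<in> points_in UNIV"
    and "vec.span (\<Union>i\<in>{0..t - 1}. (\<sigma> ^^ i) P) = UNIV"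
    and "\<Gamma> = vec.span (\<Union>i\<in>{0..t - 3}. (\<sigma> ^^ i) P)"
  shows "real (card {S. subline q l\<^sub>0 S \<and> S \<subseteq> L \<and>
            (\<exists>C. normal_rational_curve C \<and> (\<forall>i\<in>{0..t - 1}. (\<sigma> ^^ i) P \<in> C) \<and>
                 S = projection \<Gamma> l\<^sub>0 (C \<inter> Sub))})
         = theta q (t - 1) * theta q (t - 2) / theta q 1"
proof -
  have t0: "t > 0" and q: "q > 1" and n2: "CARD('n) \<ge> 2"
    using assms(2,3,5) by auto
  obtain B :: "'k ^ 'n \<Rightarrow> 'k ^ 'n" where B: "Vector_Spaces.linear (*s) (*s) B" "bij B"
    and Sub: "Sub = {pt (B x) | x. x \<noteq> 0 \<and> (\<forall>i. x $ i \<in> Fq q)}"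
    by (rule canonical_subgeometry_frame[OF assms(6)])
  have stab: "\<sigma> \<in> pointwise_stabilizer {pt (B x) | x. x \<noteq> 0 \<and> (\<forall>i. x $ i \<in> Fq q)}"
    using assms(14) unfolding stabilizer_generator_def Sub by blast
  have q0: "q > 0" using q by simp
  obtain f0 \<alpha> c where f0: "semilinear_bij f0" "\<sigma> = restrict ((`) f0) (points_in UNIV)"
    and \<alpha>: "field_automorphism \<alpha>" "\<forall>x\<in>Fq q. \<alpha> x = x"
    and c: "c \<noteq> 0" and f0B: "\<forall>x. f0 (B x) = c *s B (\<chi> i. \<alpha> (x $ i))"
    by (rule pointwise_stabilizer_frame[OF B n2 q0 stab])
  interpret field_aut \<alpha> q t
  proof
    show "\<alpha> x = x \<longleftrightarrow> x \<in> Fq q" for x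
      using fixed_field_stabilizer_generator[OF assms(4) t0 n2 B Sub assms(14) f0 \<alpha>(1) c f0B[rule_format]] \<alpha>(2) by blast
    show "(\<alpha> ^^ t) x = x" for x
      using \<alpha> by (intro automorphism_funpow_id[OF assms(4) t0]) auto
  qed (fact assms \<alpha>)+
  \<comment> \<open>Rescaling \<open>f0\<close> leaves the collineation unchanged and makes it act
    on frame coordinates exactly by \<open>\<alpha>\<close>.\<close>
  define f where "f v = inverse c *s f0 v" for v
  have fB: "f (B x) = B (\<chi> i. \<alpha> (x $ i))" for x using c by (simp add: f_def f0B)
  have \<sigma>_pt: "\<sigma> (pt v) = pt (f v)" "f v \<noteq> 0" if "v \<noteq> 0" for v
  proof -
    have "pt v \<in> points_in UNIV" using that by (auto simp: points_in_UNIV_iff)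
    thus "\<sigma> (pt v) = pt (f v)" using c
      by (simp add: f0(2) semilinear_image_pt[OF f0(1)] f_def pt_scale)
    show "f v \<noteq> 0" using semilinear_eq_0[OF f0(1)] c that by (simp add: f_def)
  qed
  obtain v where v: "v \<noteq> 0" "P = pt v" using assms(15) by (auto simp: points_in_UNIV_iff)
  have \<sigma>P: "(\<sigma> ^^ i) P = pt ((f ^^ i) v) \<and> (f ^^ i) v \<noteq> 0" for i
    by (induction i) (simp_all add: v \<sigma>_pt)
  define T where "T x = (\<Sum>i\<in>UNIV. x $ i *s (f ^^ idx i) v)" for x :: "'k ^ 'n"
  have indices: "{0..t - 1} = {..<CARD('n)}" using t0 by (auto simp: assms(5))
  hence span: "vec.span ((\<lambda>i. (f ^^ i) v) ` {..<CARD('n)}) = UNIV"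
    using assms(16) \<sigma>P by (simp add: span_Union_pt)
  have T: "Vector_Spaces.linear (*s) (*s) T" "bij T" "T (axis i 1) = (f ^^ idx i) v" for i
    unfolding T_def[abs_def] by (rule linear_combination_bij[OF span])+
  \<comment> \<open>The positions of the two frame points, with exponents \<open>t - 2\<close> and
    \<open>t - 1\<close>, that are not among the generators of \<open>\<Gamma>\<close>.\<close>
  obtain i1 i2 :: 'n where i12: "idx i1 = t - 2" "idx i2 = t - 1"
    using ex_idx[where ?'n = 'n, of "t - 2"] ex_idx[where ?'n = 'n, of "t - 1"] t0 assms(5) by auto
  have \<Gamma>: "\<Gamma> = vec.span ((\<lambda>i. T (axis i 1)) ` (UNIV - {i1, i2}))"
  proof -
    have idx: "idx ` (UNIV - {i1, i2}) = {0..t - 3}"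
    proof -
      have "idx ` (UNIV - {i1, i2}) = {..<CARD('n)} - {t - 2, t - 1}"
        using bij_idx[where ?'n = 'n] by (simp add: bij_betw_def image_set_diff i12)
      also have "\<dots> = {0..t - 3}" using assms(2,5) by auto
      finally show ?thesis .
    qed
    have "(\<lambda>i. T (axis i 1)) ` (UNIV - {i1, i2}) = (\<lambda>i. (f ^^ i) v) ` {0..t - 3}"
      unfolding idx[symmetric] by (simp only: T(3) image_image)
    thus ?thesis using assms(17) \<sigma>P by (simp add: span_Union_pt)
  qed
  \<comment> \<open>Disjointness is assumed for points; a nonzero common vector would generate a
    common point.\<close>
  have meet: "l\<^sub>0 \<inter> \<Gamma> \<subseteq> {0}"
  proof
    fix w assume w: "w \<in> l\<^sub>0 \<inter> \<Gamma>"
    have "vec.subspace l\<^sub>0" "vec.subspace \<Gamma>" using assms(7,8) by (auto simp: proj_subspace_def)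
    hence "pt w \<subseteq> l\<^sub>0" "pt w \<subseteq> \<Gamma>" using w by (simp_all add: vec.span_minimal)
    moreover have "proj_subspace 0 (pt w)" if "w \<noteq> 0"
      using points_in_UNIV_iff[of "pt w"] that by (auto simp: points_in_def)
    ultimately show "w \<in> {0}" using assms(10) by (auto simp: points_in_def)
  qed
  obtain \<iota> :: "'k ^ 2 \<Rightarrow> 'k ^ 'n" where \<iota>: "Vector_Spaces.linear (*s) (*s) \<iota>" "inj \<iota>" "range \<iota> = l\<^sub>0"
    and proj: "\<forall>x. vec.span (\<Gamma> \<union> pt (T x)) \<inter> l\<^sub>0 = pt (\<iota> (vector [x $ i1, x $ i2]))"
    by (rule projection_coordinates[OF T(1,2) \<Gamma> assms(8) meet])
  define \<omega> :: "'k \<Rightarrow> 'k ^ 'n" where "\<omega> = (\<lambda>a. \<chi> i. (\<alpha> ^^ idx i) a)"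
  interpret normal_form \<alpha> q t T \<iota> \<Gamma> l\<^sub>0 \<omega>
    by (intro normal_form.intro normal_form_axioms.intro field_aut_axioms T(1,2) \<iota>)
       (simp_all add: assms(5) \<omega>_def proj i12 del: One_nat_def)
  have "Sub = pt ` {B x | x. x \<noteq> 0 \<and> (\<forall>i. x $ i \<in> Fq q)}"
    unfolding Sub by blast
  also have "{B x | x. x \<noteq> 0 \<and> (\<forall>i. x $ i \<in> Fq q)} = {T (\<omega> a) | a. a \<noteq> 0}"
    unfolding \<omega>_def by (rule subgeometry_in_cyclic_frame[OF field_aut_axioms assms(5) B fB T])
  also have "pt ` \<dots> = {pt (T (\<omega> a)) | a. a \<noteq> 0}" by blast
  finally have Sub': "Sub = {pt (T (\<omega> a)) | a. a \<noteq> 0}" .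
  have "(\<forall>i\<in>{0..t - 1}. (\<sigma> ^^ i) P \<in> C) \<longleftrightarrow> (\<forall>i. pt (T (axis i 1)) \<in> C)" for C
  proof -
    have "{0..t - 1} = range (idx :: 'n \<Rightarrow> nat)"
      unfolding bij_betw_imp_surj_on[OF bij_idx] by (rule indices)
    thus ?thesis using \<sigma>P by (simp add: T(3))
  qed
  hence "{S. subline q l\<^sub>0 S \<and> S \<subseteq> L \<and>
            (\<exists>C. normal_rational_curve C \<and> (\<forall>i\<in>{0..t - 1}. (\<sigma> ^^ i) P \<in> C) \<and>
                 S = projection \<Gamma> l\<^sub>0 (C \<inter> Sub))} =
      {S. subline q l\<^sub>0 S \<and> S \<subseteq> projection \<Gamma> l\<^sub>0 {pt (T (\<omega> a)) | a. a \<noteq> 0} \<and>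
      (\<exists>C. (normal_rational_curve C \<and> (\<forall>i. pt (T (axis i 1)) \<in> C)) \<and>
         S = projection \<Gamma> l\<^sub>0 (C \<inter> {pt (T (\<omega> a)) | a. a \<noteq> 0}))}"
    unfolding assms(11) Sub' by (simp only: conj_assoc)
  thus ?thesis using theta_identity[OF q assms(2) card_sublines] by (simp only:)
qed

end
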